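(* Let $T$ be a rooted plane tree of depth $n\ge1$ which is not a path. The metric $n$-bracketing complex $\mathcal K^{\mathrm{met}}(T)$ is an abstract fan whose face poset is $\mathcal K(T)$ (the conical set $\tau^{\mathrm{met}}(\mathcal B)$ corresponding to $\mathcal B$).
   Context: **Trees.** A rooted plane tree $T$ is a finite rooted tree with a total order on the set $\mathrm{ch}(u)$ of children of every vertex $u$. $V^k(T)$ is the set of vertices at distance $k$ from the root; the depth of $T$ is the largest $k$ with $V^k(T)\ne\emptyset$. $T$ has depth $n\ge1$ and is not a path. **Brackets.** For $0\le k\le n$ a $k$-bracket of $T$ is $A=(A^0,\dots,A^k)$ with $A^i\subseteq V^i(T)$, $A^k\neq\emptyset$, such that the parent of every $u\in A^i$ ($i\ge 1$) lies in $A^{i-1}$, and for every $u\in A^{i-1}$ the set $A^i\cap\mathrm{ch}(u)$ is a (possibly empty) set of consecutive elements of $\mathrm{ch}(u)$. For $k$-brackets, $A\subseteq A'$ means $A^i\subseteq A'^i$ for all $i$. For $k\ge1$, $\pi(A)=(A^0,\dots,A^{k-1})$. The singleton $k$-bracket $A(u)$ of $u\in V^k(T)$ has $A(u)^i=\{\text{the depth-}i\text{ vertex on the path from the root to }u\}$; the maximum $k$-bracket is $(V^0(T),\dots,V^k(T))$. A bracket is nontrivial if it is neither singleton nor maximum. **$n$-bracketings.** An $n$-bracketing $\mathcal B$ of $T$ consists of sets $\mathcal B^k$ of $k$-brackets ($0\le k\le n$) and a strict partial order $<_{\mathcal B}$ on $\bigsqcup_k\mathcal B^k$ such that, writing $\mathcal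 B_A=\{A'\in\mathcal B^{k}:\pi(A')=A\}$ for $A\in\mathcal B^{k-1}$: (1) $\mathcal B^k$ contains the maximum and all singleton $k$-brackets; (2) $A\in\mathcal B^k$, $k\ge1$, implies $\pi(A)\in\mathcal B^{k-1}$; (3) if $A_1,A_2\in\mathcal B^k$ and $A_1^k\cap A_2^k\ne\emptyset$ then $A_1\subseteq A_2$ or $A_2\subseteq A_1$; (4a) for $A\in\mathcal B^{k-1}$, $1\le k\le n$: $\bigcup_{A'\in\mathcal B_A}A'^k=\bigcup_{u\in A^{k-1}}\mathrm{ch}(u)$; (4b) if $A_1,A_2\in\mathcal B_A$, $A_2\subsetneq A_1$, then every $u'\in A_1^k$ lies in $A_3^k$ for some $A_3\in\mathcal B_A$ with $A_3\subsetneq A_1$; (5a) distinct elements $A_1,A_2\in\mathcal B^k$ are comparable under $<_{\mathcal B}$ iff $\pi(A_1)=\pi(A_2)$ and $A_1^k\cap A_2^k=\emptyset$ (elements of different levels are incomparable); (5b) if $u_1$ precedes $u_2$ in $\mathrm{ch}(u)$ then $A(u_1)<_{\mathcal B}A(u_2)$; (5c) if $A,\tilde A\in\mathcal B^{k-1}$, $\tilde A\subseteq A$, $A_1\ne A_2\in\mathcal B_A$ are comparable, $\tilde A_1\ne\tilde A_2\in\mathcal B_{\tilde A}$ are comparable, and $\tilde A_i\subseteq A_i$ for $i=1,2$, then $A_1<_{\mathcal B}A_2\iff\tilde A_1<_{\mathcal B}\tilde A_2$. The categorical $n$-associahedron $\mathcal K(T)$ is the set of $n$-bracketings of $T$ ordered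 by: $\mathcal B_1\le\mathcal B_2$ iff $\mathcal B_1^k\subseteq\mathcal B_2^k$ for all $k$ and $<_{\mathcal B_1}$ is the restriction of $<_{\mathcal B_2}$. Its minimum $\mathcal B_{\min}$ has only singleton and maximum brackets. **Metric $n$-bracketings.** A metric $n$-bracketing is a pair $(\mathcal B,\ell_{\mathcal B})$ with $\mathcal B\in\mathcal K(T)$ and $\ell_{\mathcal B}$ a real function on the brackets of $T$ such that: $\ell_{\mathcal B}(A)=0$ if $A$ is not in $\mathcal B$; $\ell_{\mathcal B}(A)=0$ if $A$ is singleton; $\ell_{\mathcal B}(A)>0$ if $A$ is a nontrivial bracket of $\mathcal B$; and for every nonsingleton $\tilde A\in\mathcal B^k$ and $A,A'\in\mathcal B_{\tilde A}$ with $A$ containment-maximal in $\mathcal B_{\tilde A}$, $A'$ containment-minimal in $\mathcal B_{\tilde A}$ and $A'\subseteq A$, one has $\ell_{\mathcal B}(\tilde A)=\sum_{A''\in\mathcal B_{\tilde A},\,A'\subseteq A''\subseteq A}\ell_{\mathcal B}(A'')$. Let $\tau^{\mathrm{met}}(\mathcal B)$ be the set of metric $n$-bracketings $(\mathcal B',\ell_{\mathcal B'})$ with $\mathcal B'\le\mathcal B$; it is an $\mathbb R_{\ge0}$-semimodule via $(\mathcal B_1,\ell_1)+(\mathcal B_2,\ell_2)=(\mathcal B_1\vee\mathcal B_2,\ell_1+\ell_2)$ (join in $\mathcal K(T)$) and $t(\mathcal B',\ell)=(\mathcal B',t\ell)$ for $t>0$, with zero element $(\mathcal B_{\min},0)$.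 $\mathcal K^{\mathrm{met}}(T)=\{\tau^{\mathrm{met}}(\mathcal B):\mathcal B\in\mathcal K(T)\}$, all contained in the set of all metric $n$-bracketings. **Abstract fans.** A conical set is a semimodule over $\mathbb R_{\ge0}$. A face of a conical set $\tau_1$ is a sub-semimodule $\tau_2$ such that for all $\lambda>0$, $x,y\in\tau_1$: $\lambda x\in\tau_2\Rightarrow x\in\tau_2$, and $x+y\in\tau_2\Rightarrow x,y\in\tau_2$. An abstract cone is a conical set admitting a linear isomorphism to a closed polyhedral cone in some $\mathbb R^N$ (not necessarily pointed). An abstract fan is a finite collection of abstract cones contained in a common set, such that every face of a member is a member, and the intersection of any two members is a face of both. Its face poset is the set of members ordered by "is a face of". *)

theory Defs
  imports
    Complex_Main
    "HOL-Algebra.Lattice"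
    "HOL-Algebra.Module"
    "HOL-Library.Sublist"
    "Jordan_Normal_Form.Matrix"
begin

section \<open>Rooted plane trees\<close>

text \<open>The list \<open>kids T u\<close> enumerates the children of \<open>u\<close> in increasing order.\<close>

record 'v plane_tree =
  verts :: "'v set"
  root :: 'v
  kids :: "'v \<Rightarrow> 'v list"

definition child_rel :: "'v plane_tree \<Rightarrow> ('v \<times> 'v) set" where
  "child_rel T = {(u, v). u \<in> verts T \<and> v \<in> set (kids T u)}"

definition plane_tree :: "'v plane_tree \<Rightarrow> bool" where
  "plane_tree T \<longleftrightarrow>
     finite (verts T) \<and> root T \<in> verts T \<and>
     (\<forall>u\<in>verts T. distinct (kids T u) \<and> set (kids T u) \<subseteq> verts T - {root T}) \<and>
     (\<forall>v\<in>verts T - {root T}. \<exists>!u. (u, v) \<in> child_rel T) \<and>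
     (\<forall>v\<in>verts T. (root T, v) \<in> (child_rel T)\<^sup>*)"

definition level :: "'v plane_tree \<Rightarrow> nat \<Rightarrow> 'v set" where
  "level T k = {v. (root T, v) \<in> child_rel T ^^ k}"

definition depth :: "'v plane_tree \<Rightarrow> nat" where
  "depth T = Max {k. level T k \<noteq> {}}"

text \<open>A path is a tree without branching; a root in the interior of a linear graph is branching.\<close>

definition is_path :: "'v plane_tree \<Rightarrow> bool" where
  "is_path T \<longleftrightarrow> (\<forall>u\<in>verts T. length (kids T u) \<le> 1)"

definition precedes :: "'v list \<Rightarrow> 'v \<Rightarrow> 'v \<Rightarrow> bool" where
  "precedes us u v \<longleftrightarrow> (\<exists>i j. i < j \<and> j < length us \<and> us ! i = u \<and> us ! j = v)"


section \<open>Brackets\<close>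

text \<open>
  A \<open>k\<close>-bracket is a list of length \<open>k + 1\<close>, so brackets of different levels are distinct
  objects, \<open>last\<close> is the top component of a bracket, and \<open>butlast\<close> is the projection \<open>\<pi>\<close>.
\<close>

type_synonym 'v bracket = "'v set list"

definition brackets :: "'v plane_tree \<Rightarrow> nat \<Rightarrow> 'v bracket set" where
  "brackets T k = {A.
     length A = Suc k \<and> (\<forall>i\<le>k. A ! i \<subseteq> level T i) \<and> last A \<noteq> {} \<and>
     (\<forall>i<k. (\<forall>v\<in>A ! Suc i. \<forall>u. (u, v) \<in> child_rel T \<longrightarrow> u \<in> A ! i) \<and>
            (\<forall>u\<in>A ! i. \<exists>us. sublist us (kids T u) \<and> set us = A ! Suc i \<inter> set (kids T u)))}"

definition sub_bracket :: "'v bracket \<Rightarrow> 'v bracket \<Rightarrow> bool" (infix \<open>\<preceq>\<close> 50) where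
  "A \<preceq> A' \<longleftrightarrow> list_all2 (\<subseteq>) A A'"

definition psub_bracket :: "'v bracket \<Rightarrow> 'v bracket \<Rightarrow> bool" (infix \<open>\<prec>\<close> 50) where
  "A \<prec> A' \<longleftrightarrow> A \<preceq> A' \<and> A \<noteq> A'"

text \<open>
  The \<open>i\<close>-th component consists of the ancestor of \<open>u\<close> (possibly \<open>u\<close> itself) at distance
  \<open>i\<close> from the root.
\<close>

definition singleton_bracket :: "'v plane_tree \<Rightarrow> nat \<Rightarrow> 'v \<Rightarrow> 'v bracket" where
  "singleton_bracket T k u = map (\<lambda>i. {w \<in> level T i. (w, u) \<in> (child_rel T)\<^sup>*}) [0..<Suc k]"

definition max_bracket :: "'v plane_tree \<Rightarrow> nat \<Rightarrow> 'v bracket" where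
  "max_bracket T k = map (level T) [0..<Suc k]"

definition is_singleton_bracket :: "'v plane_tree \<Rightarrow> 'v bracket \<Rightarrow> bool" where
  "is_singleton_bracket T A \<longleftrightarrow> (\<exists>k\<le>depth T. \<exists>u\<in>level T k. A = singleton_bracket T k u)"

definition is_max_bracket :: "'v plane_tree \<Rightarrow> 'v bracket \<Rightarrow> bool" where
  "is_max_bracket T A \<longleftrightarrow> (\<exists>k\<le>depth T. A = max_bracket T k)"

definition nontrivial_bracket :: "'v plane_tree \<Rightarrow> 'v bracket \<Rightarrow> bool" where
  "nontrivial_bracket T A \<longleftrightarrow> \<not> is_singleton_bracket T A \<and> \<not> is_max_bracket T A"


section \<open>Bracketings and the categorical associahedron\<close>

text \<open>
  Since \<open>brackets T k\<close> is empty for \<open>k\<close> above the depth, so is \<open>brs B k\<close>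
  for every bracketing \<open>B\<close>.
\<close>

record 'v bracketing =
  brs :: "nat \<Rightarrow> 'v bracket set"
  prec :: "('v bracket \<times> 'v bracket) set"

definition all_brs :: "'v bracketing \<Rightarrow> 'v bracket set" where
  "all_brs B = (\<Union>k. brs B k)"

text \<open>
  The set written \<open>\<B>\<^sub>A\<close> in the literature: for \<open>A\<close> of level \<open>k - 1\<close>, i.e. of length \<open>k\<close>,
  the members of \<open>\<B>\<close> of level \<open>k\<close> projecting to \<open>A\<close>.
\<close>

definition lifts :: "'v bracketing \<Rightarrow> 'v bracket \<Rightarrow> 'v bracket set" where
  "lifts B A = {A' \<in> brs B (length A). butlast A' = A}"

definition comparable :: "'v bracketing \<Rightarrow> 'v bracket \<Rightarrow> 'v bracket \<Rightarrow> bool" where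
  "comparable B A1 A2 \<longleftrightarrow> (A1, A2) \<in> prec B \<or> (A2, A1) \<in> prec B"

definition bracketing :: "'v plane_tree \<Rightarrow> 'v bracketing \<Rightarrow> bool" where
  "bracketing T B \<longleftrightarrow>
     (\<forall>k. brs B k \<subseteq> brackets T k) \<and>
     \<comment> \<open>strict partial order, relating only brackets of equal level\<close>
     prec B \<subseteq> (\<Union>k. brs B k \<times> brs B k) \<and> irrefl (prec B) \<and> trans (prec B) \<and>
     \<comment> \<open>(1)\<close>
     (\<forall>k\<le>depth T. max_bracket T k \<in> brs B k \<and>
        (\<forall>u\<in>level T k. singleton_bracket T k u \<in> brs B k)) \<and>
     \<comment> \<open>(2)\<close>
     (\<forall>k. \<forall>A\<in>brs B (Suc k). butlast A \<in> brs B k) \<and>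
     \<comment> \<open>(3)\<close>
     (\<forall>k. \<forall>A1\<in>brs B k. \<forall>A2\<in>brs B k. last A1 \<inter> last A2 \<noteq> {} \<longrightarrow> A1 \<preceq> A2 \<or> A2 \<preceq> A1) \<and>
     \<comment> \<open>(4a)\<close>
     (\<forall>k<depth T. \<forall>A\<in>brs B k. (\<Union>A'\<in>lifts B A. last A') = (\<Union>u\<in>last A. set (kids T u))) \<and>
     \<comment> \<open>(4b)\<close>
     (\<forall>k<depth T. \<forall>A\<in>brs B k. \<forall>A1\<in>lifts B A. \<forall>A2\<in>lifts B A. A2 \<prec> A1 \<longrightarrow>
        (\<forall>u\<in>last A1. \<exists>A3\<in>lifts B A. A3 \<prec> A1 \<and> u \<in> last A3)) \<and>
     \<comment> \<open>(5a)\<close>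
     (\<forall>k. \<forall>A1\<in>brs B k. \<forall>A2\<in>brs B k. A1 \<noteq> A2 \<longrightarrow>
        (comparable B A1 A2 \<longleftrightarrow> butlast A1 = butlast A2 \<and> last A1 \<inter> last A2 = {})) \<and>
     \<comment> \<open>(5b)\<close>
     (\<forall>k<depth T. \<forall>u\<in>level T k. \<forall>u1 u2. precedes (kids T u) u1 u2 \<longrightarrow>
        (singleton_bracket T (Suc k) u1, singleton_bracket T (Suc k) u2) \<in> prec B) \<and>
     \<comment> \<open>(5c)\<close>
     (\<forall>k<depth T. \<forall>A\<in>brs B k. \<forall>A'\<in>brs B k. A' \<preceq> A \<longrightarrow>
        (\<forall>A1\<in>lifts B A. \<forall>A2\<in>lifts B A. \<forall>A1'\<in>lifts B A'. \<forall>A2'\<in>lifts B A'.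
           A1 \<noteq> A2 \<and> comparable B A1 A2 \<and> A1' \<noteq> A2' \<and> comparable B A1' A2' \<and>
           A1' \<preceq> A1 \<and> A2' \<preceq> A2 \<longrightarrow>
           ((A1, A2) \<in> prec B \<longleftrightarrow> (A1', A2') \<in> prec B)))"

definition bracketing_le :: "'v bracketing \<Rightarrow> 'v bracketing \<Rightarrow> bool" where
  "bracketing_le B1 B2 \<longleftrightarrow>
     (\<forall>k. brs B1 k \<subseteq> brs B2 k) \<and> prec B1 = prec B2 \<inter> (all_brs B1 \<times> all_brs B1)"

definition cat_assoc :: "'v plane_tree \<Rightarrow> 'v bracketing gorder" where
  "cat_assoc T = \<lparr>carrier = {B. bracketing T B}, eq = (=), le = bracketing_le\<rparr>"


section \<open>Metric bracketings\<close>

type_synonym 'v metric_bracketing = "'v bracketing \<times> ('v bracket \<Rightarrow> real)"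

text \<open>
  In the last clause \<open>C\<close> is the base bracket; at top level \<open>lifts B C\<close> is empty and the
  clause is void. The length function is total on lists of sets and vanishes off \<open>B\<close>.
\<close>

definition metric_bracketing :: "'v plane_tree \<Rightarrow> 'v metric_bracketing \<Rightarrow> bool" where
  "metric_bracketing T x \<longleftrightarrow> (case x of (B, l) \<Rightarrow>
     bracketing T B \<and>
     (\<forall>A. A \<notin> all_brs B \<longrightarrow> l A = 0) \<and>
     (\<forall>A. is_singleton_bracket T A \<longrightarrow> l A = 0) \<and>
     (\<forall>A\<in>all_brs B. nontrivial_bracket T A \<longrightarrow> l A > 0) \<and>
     (\<forall>C\<in>all_brs B. \<not> is_singleton_bracket T C \<longrightarrow>
        (\<forall>A\<in>lifts B C. \<forall>A'\<in>lifts B C.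
           (\<forall>D\<in>lifts B C. \<not> A \<prec> D) \<and> (\<forall>D\<in>lifts B C. \<not> D \<prec> A') \<and> A' \<preceq> A \<longrightarrow>
           l C = (\<Sum>D\<in>{D \<in> lifts B C. A' \<preceq> D \<and> D \<preceq> A}. l D))))"

definition tau_met :: "'v plane_tree \<Rightarrow> 'v bracketing \<Rightarrow> 'v metric_bracketing set" where
  "tau_met T B = {x. metric_bracketing T x \<and> fst x \<sqsubseteq>\<^bsub>cat_assoc T\<^esub> B}"

text \<open>
  The common set of all metric bracketings with its (partially meaningful) operations: the sum
  is only significant for pairs having a common upper bound in the categorical associahedron.
  The components \<open>mult\<close> and \<open>one\<close> of the library record play no role.
\<close>

definition met_space :: "'v plane_tree \<Rightarrow> (real, 'v metric_bracketing) module" where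
  "met_space T = \<lparr>
     carrier = {x. metric_bracketing T x},
     mult = undefined, one = undefined,
     zero = (\<bottom>\<^bsub>cat_assoc T\<^esub>, \<lambda>A. 0),
     add = (\<lambda>(B1, l1) (B2, l2). (B1 \<squnion>\<^bsub>cat_assoc T\<^esub> B2, \<lambda>A. l1 A + l2 A)),
     smult = (\<lambda>t (B, l). if t = 0 then (\<bottom>\<^bsub>cat_assoc T\<^esub>, \<lambda>A. 0) else (B, \<lambda>A. t * l A))\<rparr>"

definition K_met :: "'v plane_tree \<Rightarrow> 'v metric_bracketing set set" where
  "K_met T = tau_met T ` carrier (cat_assoc T)"


section \<open>Abstract fans\<close>

text \<open>A semimodule over the nonnegative reals.\<close>

locale conical_set = abelian_monoid M for M :: "(real, 'a) module" (structure) +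
  assumes smult_closed: "\<lbrakk>0 \<le> t; x \<in> carrier M\<rbrakk> \<Longrightarrow> t \<odot> x \<in> carrier M"
    and smult_l_distr: "\<lbrakk>0 \<le> s; 0 \<le> t; x \<in> carrier M\<rbrakk> \<Longrightarrow> (s + t) \<odot> x = s \<odot> x \<oplus> t \<odot> x"
    and smult_r_distr: "\<lbrakk>0 \<le> t; x \<in> carrier M; y \<in> carrier M\<rbrakk> \<Longrightarrow> t \<odot> (x \<oplus> y) = t \<odot> x \<oplus> t \<odot> y"
    and smult_assoc: "\<lbrakk>0 \<le> s; 0 \<le> t; x \<in> carrier M\<rbrakk> \<Longrightarrow> (s * t) \<odot> x = s \<odot> (t \<odot> x)"
    and smult_one: "x \<in> carrier M \<Longrightarrow> 1 \<odot> x = x"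
    and smult_l_zero: "x \<in> carrier M \<Longrightarrow> 0 \<odot> x = \<zero>"
    and smult_r_zero: "0 \<le> t \<Longrightarrow> t \<odot> \<zero> = \<zero>"

text \<open>
  The operations of \<open>M\<close> are shared by all subsets of its carrier; \<open>M\<close> itself need not be
  a conical set, only the restrictions \<open>M\<lparr>carrier := S\<rparr>\<close> under consideration.
\<close>

definition is_face :: "(real, 'a) module \<Rightarrow> 'a set \<Rightarrow> 'a set \<Rightarrow> bool" where
  "is_face M S2 S1 \<longleftrightarrow>
     S2 \<subseteq> S1 \<and> conical_set (M\<lparr>carrier := S2\<rparr>) \<and>
     (\<forall>t>0. \<forall>x\<in>S1. t \<odot>\<^bsub>M\<^esub> x \<in> S2 \<longrightarrow> x \<in> S2) \<and>
     (\<forall>x\<in>S1. \<forall>y\<in>S1. x \<oplus>\<^bsub>M\<^esub> y \<in> S2 \<longrightarrow> x \<in> S2 \<and> y \<in> S2)"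

definition polyhedral_cone :: "nat \<Rightarrow> real vec set \<Rightarrow> bool" where
  "polyhedral_cone N C \<longleftrightarrow>
     (\<exists>m. \<exists>Q\<in>carrier_mat m N. C = {x \<in> carrier_vec N. 0\<^sub>v m \<le> Q *\<^sub>v x})"

definition abstract_cone :: "(real, 'a) module \<Rightarrow> bool" where
  "abstract_cone M \<longleftrightarrow> conical_set M \<and>
     (\<exists>N C f. polyhedral_cone N C \<and> bij_betw f (carrier M) C \<and>
        (\<forall>x\<in>carrier M. \<forall>y\<in>carrier M. f (x \<oplus>\<^bsub>M\<^esub> y) = f x + f y) \<and>
        (\<forall>t\<ge>0. \<forall>x\<in>carrier M. f (t \<odot>\<^bsub>M\<^esub> x) = t \<cdot>\<^sub>v f x))"

definition abstract_fan :: "(real, 'a) module \<Rightarrow> 'a set set \<Rightarrow> bool" where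
  "abstract_fan M F \<longleftrightarrow>
     finite F \<and>
     (\<forall>S\<in>F. S \<subseteq> carrier M \<and> abstract_cone (M\<lparr>carrier := S\<rparr>)) \<and>
     (\<forall>S\<in>F. \<forall>S'. is_face M S' S \<longrightarrow> S' \<in> F) \<and>
     (\<forall>S1\<in>F. \<forall>S2\<in>F. is_face M (S1 \<inter> S2) S1 \<and> is_face M (S1 \<inter> S2) S2)"

definition face_poset :: "(real, 'a) module \<Rightarrow> 'a set set \<Rightarrow> 'a set gorder" where
  "face_poset M F = \<lparr>carrier = F, eq = (=), le = is_face M\<rparr>"

end

theory Submission
  imports Defs
begin

text \<open>
  A maximal chain of lifts of a bracket \<open>C\<close> is the set of all lifts of \<open>C\<close> that contain a given
  child \<open>v\<close> of a vertex of \<open>C\<close>. Hence the length condition says that \<open>l C\<close> is the sum of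
  \<open>l D\<close> over all brackets \<open>D\<close> over \<open>C\<close> with \<open>v \<in> last D\<close>, a system of linear equations
  that does not mention the bracketing. A solution supported on \<open>B\<close> and nonnegative on nontrivial
  brackets determines its bracketing, namely the restriction of \<open>B\<close> to its support and the trivial
  brackets; so \<open>tau_met T B\<close> is the polyhedral cone of these solutions, and sums in it correspond
  to unions of supports. A face of this cone is cut out by an element of maximal support, and since
  every bracketing carries a length that is positive on all its nontrivial brackets, faces
  correspond to smaller bracketings.
\<close>

section \<open>Trees and brackets\<close>

text \<open>Two features of the definitions shape the argument. Maximum brackets carry no sign
  condition: their lengths may vanish, be negative, and cancel in sums, so the cones need not be
  pointed. Supports are therefore read off on nontrivial brackets only. Positivity arguments have to
  avoid maximum brackets; they can, because neither a lift strictly inside another lift nor a lift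
  of a nonmaximum bracket is maximum. Secondly, a join is least among all common upper bounds, and
  each of these brings its own order on brackets. To recognize it as the support of a sum inside
  \<open>B\<close>, the order between a bracket of one summand and a bracket of the other must be
  forced by the two summands alone; (5c) does this. The delicate axiom for supports is (4b):
  vanishing lengths might delete the lifts inside some \<open>D\<close> through one child and keep
  those through another. The length equations exclude this, since all chains through
  \<open>D\<close> share \<open>D\<close> and everything above it.\<close>

lemma sub_bracket_refl: "A \<preceq> A"
  by (simp add: sub_bracket_def list_all2_refl)

text \<open>Lifts of one base can differ only in the last component, so containment among them is
  inclusion of sets of vertices.\<close>

lemma sub_bracket_butlast_iff:
  assumes "A \<noteq> []" "A' \<noteq> []" "butlast A = butlast A'"
  shows "A \<preceq> A' \<longleftrightarrow> last A \<subseteq> last A'"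
proof -
  have "A = butlast A @ [last A]" "A' = butlast A @ [last A']"
    using assms by (metis append_butlast_last_id)+
  then have "A \<preceq> A' \<longleftrightarrow> list_all2 (\<subseteq>) (butlast A @ [last A]) (butlast A @ [last A'])"
    by (simp add: sub_bracket_def)
  also have "\<dots> \<longleftrightarrow> last A \<subseteq> last A'"
    by (subst list_all2_append) (auto simp: list_all2_refl)
  finally show ?thesis .
qed

lemma bracket_eq_butlast_iff:
  assumes "A \<noteq> []" "A' \<noteq> []" "butlast A = butlast A'"
  shows "A = A' \<longleftrightarrow> last A = last A'"
  using assms by (metis append_butlast_last_id)

lemma psub_bracket_butlast_iff:
  assumes "A \<noteq> []" "A' \<noteq> []" "butlast A = butlast A'"
  shows "A \<prec> A' \<longleftrightarrow> last A \<subset> last A'"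
  using sub_bracket_butlast_iff[OF assms] bracket_eq_butlast_iff[OF assms]
  by (auto simp: psub_bracket_def)

locale rooted_plane_tree =
  fixes T :: "'v plane_tree"
  assumes tree: "plane_tree T"
begin

lemma child_relD:
  assumes "(u, v) \<in> child_rel T"
  shows "u \<in> verts T" "v \<in> verts T" "v \<noteq> root T" "v \<in> set (kids T u)"
  using assms tree by (auto simp: child_rel_def plane_tree_def)

lemma child_relI: "\<lbrakk>u \<in> verts T; v \<in> set (kids T u)\<rbrakk> \<Longrightarrow> (u, v) \<in> child_rel T"
  by (simp add: child_rel_def)

lemma parent_unique:
  assumes "(u, v) \<in> child_rel T" "(u', v) \<in> child_rel T"
  shows "u = u'"
proof -
  have "v \<in> verts T - {root T}" using assms(1) child_relD by blast
  then have "\<exists>!u. (u, v) \<in> child_rel T" using tree by (simp add: plane_tree_def)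
  with assms show ?thesis by blast
qed

lemma level_0: "level T 0 = {root T}"
  by (auto simp: level_def)

lemma level_Suc: "level T (Suc k) = {v. \<exists>u\<in>level T k. (u, v) \<in> child_rel T}"
  by (auto simp: level_def)

lemma level_verts: "level T k \<subseteq> verts T"
  by (cases k) (use tree in \<open>auto simp: level_0 level_Suc plane_tree_def dest: child_relD\<close>)

lemma level_childI: "\<lbrakk>u \<in> level T k; v \<in> set (kids T u)\<rbrakk> \<Longrightarrow> v \<in> level T (Suc k)"
  using level_verts[of k] by (auto simp: level_Suc intro: child_relI)

lemma level_kids: "v \<in> level T (Suc k) \<longleftrightarrow> (\<exists>u\<in>level T k. v \<in> set (kids T u))"
  using level_childI by (auto simp: level_Suc dest: child_relD)

lemma level_unique:
  assumes "v \<in> level T i" "v \<in> level T j"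
  shows "i = j"
  using assms
proof (induction i arbitrary: v j)
  case 0
  then show ?case by (cases j) (auto simp: level_0 level_Suc dest: child_relD)
next
  case (Suc i)
  obtain u where u: "u \<in> level T i" "(u, v) \<in> child_rel T" using Suc.prems by (auto simp: level_Suc)
  obtain j' where j: "j = Suc j'"
    using Suc.prems u by (cases j) (auto simp: level_0 dest: child_relD)
  obtain u' where "u' \<in> level T j'" "(u', v) \<in> child_rel T"
    using Suc.prems j by (auto simp: level_Suc)
  with u parent_unique Suc.IH j show ?case by metis
qed

lemma finite_verts: "finite (verts T)"
  using tree by (simp add: plane_tree_def)

text \<open>Gives \<open>Max\<close> in \<open>depth\<close> its meaning. Levels are pairwise
  disjoint, so nonempty levels are no more numerous than vertices.\<close>

lemma finite_levels: "finite {k. level T k \<noteq> {}}"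
proof (rule finite_surj[OF finite_verts])
  show "{k. level T k \<noteq> {}} \<subseteq> (\<lambda>v. THE k. v \<in> level T k) ` verts T"
  proof
    fix k assume "k \<in> {k. level T k \<noteq> {}}"
    then obtain v where v: "v \<in> level T k" by auto
    then have "(THE k. v \<in> level T k) = k" by (blast intro: the_equality level_unique)
    moreover have "v \<in> verts T" using v level_verts by blast
    ultimately show "k \<in> (\<lambda>v. THE k. v \<in> level T k) ` verts T" by force
  qed
qed

lemma level_depth: "v \<in> level T k \<Longrightarrow> k \<le> depth T"
  unfolding depth_def by (rule Max_ge[OF finite_levels]) auto

lemma level_rtrancl_refl:
  assumes "w \<in> level T k" "u \<in> level T k" "(w, u) \<in> (child_rel T)\<^sup>*"
  shows "w = u"
proof -
  obtain n where "(w, u) \<in> child_rel T ^^ n" using assms(3) by (auto dest: rtrancl_imp_relpow)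
  moreover have "(root T, w) \<in> child_rel T ^^ k" using assms(1) by (simp add: level_def)
  ultimately have "u \<in> level T (k + n)" by (auto simp: level_def relpow_add)
  then have "k + n = k" using assms(2) by (rule level_unique)
  then have "n = 0" by simp
  with \<open>(w, u) \<in> child_rel T ^^ n\<close> show ?thesis by simp
qed

lemma bracketsD:
  assumes "A \<in> brackets T k"
  shows "length A = Suc k" "A \<noteq> []" "last A \<subseteq> level T k" "last A \<noteq> {}" "k \<le> depth T"
    "finite (last A)"
proof -
  show l: "length A = Suc k" and n: "last A \<noteq> {}" using assms by (auto simp: brackets_def)
  then show ne: "A \<noteq> []" by auto
  have "A ! k \<subseteq> level T k" using assms by (auto simp: brackets_def)
  then show s: "last A \<subseteq> level T k" using l ne by (simp add: last_conv_nth)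
  with n show "k \<le> depth T" using level_depth by blast
  show "finite (last A)"
    using s level_verts finite_verts by (meson finite_subset)
qed

lemma finite_brackets: "finite (brackets T k)"
proof (rule finite_subset)
  show "brackets T k \<subseteq> {A. set A \<subseteq> Pow (verts T) \<and> length A = Suc k}"
  proof
    fix A assume A: "A \<in> brackets T k"
    have "a \<subseteq> verts T" if a: "a \<in> set A" for a
    proof -
      obtain i where "i \<le> k" "a = A ! i"
        using a bracketsD(1)[OF A] by (metis in_set_conv_nth less_Suc_eq_le)
      then show ?thesis using A level_verts[of i] by (auto simp: brackets_def)
    qed
    then show "A \<in> {A. set A \<subseteq> Pow (verts T) \<and> length A = Suc k}"
      using bracketsD(1)[OF A] by auto
  qed
  show "finite {A. set A \<subseteq> Pow (verts T) \<and> length A = Suc k}"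
    by (rule finite_lists_length_eq) (simp add: finite_verts)
qed

lemma finite_all_brackets: "finite (\<Union>k. brackets T k)"
proof (rule finite_subset)
  show "(\<Union>k. brackets T k) \<subseteq> (\<Union>k\<le>depth T. brackets T k)" using bracketsD(5) by blast
qed (simp add: finite_brackets)

lemma length_singleton_bracket [simp]: "length (singleton_bracket T k u) = Suc k"
  by (simp add: singleton_bracket_def)

lemma length_max_bracket [simp]: "length (max_bracket T k) = Suc k"
  by (simp add: max_bracket_def)

lemma last_max_bracket [simp]: "last (max_bracket T k) = level T k"
  by (simp add: max_bracket_def)

lemma butlast_max_bracket [simp]: "butlast (max_bracket T (Suc k)) = max_bracket T k"
  by (simp add: max_bracket_def butlast_append)

lemma last_singleton_bracket:
  assumes "u \<in> level T k"
  shows "last (singleton_bracket T k u) = {u}"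
  using assms level_rtrancl_refl by (auto simp: singleton_bracket_def)

lemma butlast_singleton_bracket:
  assumes "u \<in> level T k" "v \<in> set (kids T u)"
  shows "butlast (singleton_bracket T (Suc k) v) = singleton_bracket T k u"
proof -
  have uv: "(u, v) \<in> child_rel T" using assms level_verts by (blast intro: child_relI)
  have v: "v \<in> level T (Suc k)" using assms by (rule level_childI)
  have "(w, v) \<in> (child_rel T)\<^sup>* \<longleftrightarrow> (w, u) \<in> (child_rel T)\<^sup>*"
    if w: "w \<in> level T i" "i \<le> k" for w i
  proof
    assume "(w, v) \<in> (child_rel T)\<^sup>*"
    moreover have "w \<noteq> v" using w v level_unique[of w i "Suc k"] by auto
    ultimately obtain u' where "(w, u') \<in> (child_rel T)\<^sup>*" "(u', v) \<in> child_rel T"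
      by (metis rtranclE)
    with uv parent_unique show "(w, u) \<in> (child_rel T)\<^sup>*" by metis
  next
    assume "(w, u) \<in> (child_rel T)\<^sup>*"
    with uv show "(w, v) \<in> (child_rel T)\<^sup>*" by (rule rtrancl_into_rtrancl[rotated])
  qed
  then show ?thesis
    by (auto simp: singleton_bracket_def butlast_append)
qed

lemma is_singleton_bracket_butlast:
  assumes "is_singleton_bracket T D" "length D = Suc (Suc k)"
  shows "is_singleton_bracket T (butlast D)"
proof -
  obtain v where v: "v \<in> level T (Suc k)" "D = singleton_bracket T (Suc k) v"
    using assms by (auto simp: is_singleton_bracket_def)
  obtain u where "u \<in> level T k" "v \<in> set (kids T u)" using v by (auto simp: level_kids)
  with v butlast_singleton_bracket level_depth show ?thesis
    unfolding is_singleton_bracket_def by metis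
qed

lemma is_max_bracket_butlast:
  assumes "is_max_bracket T D" "length D = Suc (Suc k)"
  shows "is_max_bracket T (butlast D)"
proof -
  have "D = max_bracket T (Suc k)" "Suc k \<le> depth T" using assms by (auto simp: is_max_bracket_def)
  then show ?thesis unfolding is_max_bracket_def using Suc_leD butlast_max_bracket by metis
qed

text \<open>The root is the only vertex of level 0. Consequently every nonsingleton bracket has a
  base, which grounds the recursive construction of lengths.\<close>

lemma singleton_root: 
  assumes "A \<in> brackets T 0"
  shows "is_singleton_bracket T A"
proof -
  obtain a where a: "A = [a]" using bracketsD(1)[OF assms] by (cases A) auto
  have "a = {root T}" using bracketsD(3,4)[OF assms] a level_0 by auto
  then have "A = singleton_bracket T 0 (root T)" using a level_0 by (auto simp: singleton_bracket_def)
  then show ?thesis unfolding is_singleton_bracket_def using level_0 by auto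
qed

end

section \<open>Restrictions of bracketings\<close>

text \<open>The order on bracketings forces the inherited relation on brackets, so everything below
  \<open>B\<close> has this form; only the set of retained brackets varies.\<close>

definition restrict_bracketing :: "'v bracketing \<Rightarrow> 'v bracket set \<Rightarrow> 'v bracketing" where
  "restrict_bracketing B S = \<lparr>brs = \<lambda>k. brs B k \<inter> S, prec = prec B \<inter> (S \<times> S)\<rparr>"

lemma brs_restrict [simp]: "brs (restrict_bracketing B S) k = brs B k \<inter> S"
  by (simp add: restrict_bracketing_def)

lemma all_brs_restrict [simp]: "all_brs (restrict_bracketing B S) = all_brs B \<inter> S"
  by (auto simp: all_brs_def)

lemma prec_restrict [simp]: "prec (restrict_bracketing B S) = prec B \<inter> (S \<times> S)"
  by (simp add: restrict_bracketing_def)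

lemma lifts_restrict [simp]: "lifts (restrict_bracketing B S) A = lifts B A \<inter> S"
  by (auto simp: lifts_def)

lemma bracketing_le_trans: "\<lbrakk>bracketing_le B1 B2; bracketing_le B2 B3\<rbrakk> \<Longrightarrow> bracketing_le B1 B3"
  unfolding bracketing_le_def all_brs_def by blast

lemma bracketing_le_antisym:
  assumes "bracketing_le B1 B2" "bracketing_le B2 B1"
  shows "B1 = (B2 :: 'v bracketing)"
proof -
  have "brs B1 k = brs B2 k" for k using assms by (auto simp: bracketing_le_def)
  then have "brs B1 = brs B2" by (rule ext)
  moreover have "prec B1 = prec B2" using assms unfolding bracketing_le_def by blast
  ultimately show ?thesis by simp
qed

lemma bracketing_le_all_brs: "bracketing_le B1 B2 \<Longrightarrow> all_brs B1 \<subseteq> all_brs B2"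
  by (auto simp: bracketing_le_def all_brs_def)

lemma bracketing_le_lifts: "bracketing_le B1 B2 \<Longrightarrow> lifts B1 A \<subseteq> lifts B2 A"
  by (auto simp: bracketing_le_def lifts_def)

lemma bracketing_le_prec:
  "\<lbrakk>bracketing_le B1 B2; A1 \<in> all_brs B1; A2 \<in> all_brs B1\<rbrakk> \<Longrightarrow> (A1, A2) \<in> prec B1 \<longleftrightarrow> (A1, A2) \<in> prec B2"
  by (auto simp: bracketing_le_def)

section \<open>Consequences of the bracketing axioms, stated for the lifts of a base\<close>

locale plane_bracketing = rooted_plane_tree +
  fixes B :: "'v bracketing"
  assumes br: "bracketing T B"
begin

lemma brs_brackets: "brs B k \<subseteq> brackets T k"
  using br by (simp add: bracketing_def)

text \<open>The length of a bracket records its level, so passing to \<open>all_brs\<close> loses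
  nothing.\<close>

lemma brs_all_brs: "A \<in> brs B k \<longleftrightarrow> A \<in> all_brs B \<and> length A = Suc k"
  using brs_brackets bracketsD(1) by (fastforce simp: all_brs_def)

lemma all_brs_brackets: "all_brs B \<subseteq> (\<Union>k. brackets T k)"
  using brs_brackets by (auto simp: all_brs_def)

lemma finite_all_brs: "finite (all_brs B)"
  using all_brs_brackets finite_all_brackets by (rule finite_subset)

lemma all_brsE:
  assumes "A \<in> all_brs B"
  obtains k where "A \<in> brs B k" "A \<in> brackets T k" "length A = Suc k" "k \<le> depth T"
proof -
  obtain k where k: "A \<in> brs B k" using assms by (auto simp: all_brs_def)
  with brs_brackets have "A \<in> brackets T k" by blast
  with k bracketsD show ?thesis using that by blast
qed

lemma liftsD:
  assumes "D \<in> lifts B C"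
  shows "D \<in> all_brs B" "butlast D = C" "D \<in> brackets T (length C)" "D \<noteq> []" "last D \<noteq> {}"
    "finite (last D)" "D \<in> brs B (length C)"
proof -
  show D: "butlast D = C" "D \<in> brs B (length C)" using assms by (auto simp: lifts_def)
  then show "D \<in> all_brs B" "D \<in> brackets T (length C)" using brs_brackets by (auto simp: all_brs_def)
  then show "D \<noteq> []" "last D \<noteq> {}" "finite (last D)" using bracketsD by blast+
qed

lemma lifts_sub_iff: "\<lbrakk>D \<in> lifts B C; E \<in> lifts B C\<rbrakk> \<Longrightarrow> D \<preceq> E \<longleftrightarrow> last D \<subseteq> last E"
  by (rule sub_bracket_butlast_iff) (simp_all add: liftsD)

lemma lifts_psub_iff: "\<lbrakk>D \<in> lifts B C; E \<in> lifts B C\<rbrakk> \<Longrightarrow> D \<prec> E \<longleftrightarrow> last D \<subset> last E"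
  by (rule psub_bracket_butlast_iff) (simp_all add: liftsD)

lemma lifts_eq_iff: "\<lbrakk>D \<in> lifts B C; E \<in> lifts B C\<rbrakk> \<Longrightarrow> D = E \<longleftrightarrow> last D = last E"
  by (rule bracket_eq_butlast_iff) (simp_all add: liftsD)

lemma finite_lifts: "finite (lifts B C)"
  using finite_all_brs liftsD(1) by (meson finite_subset subsetI)

lemma max_brs: "k \<le> depth T \<Longrightarrow> max_bracket T k \<in> brs B k"
  using br by (simp add: bracketing_def)

lemma singleton_brs: "u \<in> level T k \<Longrightarrow> singleton_bracket T k u \<in> brs B k"
  using br level_depth by (simp add: bracketing_def)

lemma trivial_brs:
  assumes "\<not> nontrivial_bracket T A"
  shows "A \<in> all_brs B"
proof -
  have "(\<exists>k\<le>depth T. A = max_bracket T k) \<or> (\<exists>k. \<exists>u\<in>level T k. A = singleton_bracket T k u)"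
    using assms unfolding nontrivial_bracket_def is_singleton_bracket_def is_max_bracket_def by blast
  then show ?thesis using max_brs singleton_brs unfolding all_brs_def by blast
qed

lemma butlast_brs: "A \<in> brs B (Suc k) \<Longrightarrow> butlast A \<in> brs B k"
  using br by (simp add: bracketing_def)

lemma laminar:
  assumes "A1 \<in> brs B k" "A2 \<in> brs B k" "v \<in> last A1" "v \<in> last A2"
  shows "A1 \<preceq> A2 \<or> A2 \<preceq> A1"
proof -
  have "\<forall>k. \<forall>A1\<in>brs B k. \<forall>A2\<in>brs B k. last A1 \<inter> last A2 \<noteq> {} \<longrightarrow> A1 \<preceq> A2 \<or> A2 \<preceq> A1"
    using br by (simp add: bracketing_def)
  with assms show ?thesis by blast
qed

text \<open>Hence the lifts of \<open>C\<close> through a fixed vertex \<open>v\<close> form a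
  chain.\<close>

lemma lifts_laminar:
  assumes "D \<in> lifts B C" "E \<in> lifts B C" "v \<in> last D" "v \<in> last E"
  shows "last D \<subseteq> last E \<or> last E \<subseteq> last D"
  using laminar[OF liftsD(7)[OF assms(1)] liftsD(7)[OF assms(2)] assms(3,4)]
    lifts_sub_iff[OF assms(1,2)] lifts_sub_iff[OF assms(2,1)] by simp

lemma lifts_Union:
  assumes "C \<in> brs B k" "k < depth T"
  shows "(\<Union>D\<in>lifts B C. last D) = (\<Union>u\<in>last C. set (kids T u))"
  using br assms by (simp add: bracketing_def)

lemma lifts_cover:
  assumes "C \<in> all_brs B" "u \<in> last C" "v \<in> set (kids T u)"
  obtains D where "D \<in> lifts B C" "v \<in> last D"
proof -
  obtain k where k: "C \<in> brs B k" "C \<in> brackets T k" using assms(1) by (rule all_brsE)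
  have "u \<in> level T k" using bracketsD(3)[OF k(2)] assms(2) by blast
  then have "k < depth T" using level_depth[OF level_childI[OF _ assms(3)]] Suc_le_lessD by blast
  with lifts_Union[OF k(1)] assms that show ?thesis by blast
qed

lemma lifts_parent:
  assumes "D \<in> lifts B C" "v \<in> last D" "C \<noteq> []"
  obtains u where "u \<in> last C" "v \<in> set (kids T u)"
proof -
  obtain k where k: "length C = Suc k" using assms(3) by (cases C) auto
  have D: "D \<in> brs B (Suc k)" "butlast D = C" using liftsD[OF assms(1)] k by auto
  then have C: "C \<in> brs B k" using butlast_brs by blast
  have "k < depth T" using bracketsD(5)[OF liftsD(3)[OF assms(1)]] k by simp
  with lifts_Union[OF C] assms that show ?thesis by blast
qed

lemma lifts_base:
  assumes "D \<in> lifts B C" "C \<noteq> []"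
  shows "C \<in> all_brs B"
proof -
  obtain k where "length C = Suc k" using assms(2) by (cases C) auto
  then show ?thesis using liftsD[OF assms(1)] butlast_brs unfolding all_brs_def by auto
qed

lemma lifts_refine:
  assumes "D \<in> lifts B C" "E \<in> lifts B C" "last E \<subset> last D" "v \<in> last D" "C \<noteq> []"
  obtains F where "F \<in> lifts B C" "last F \<subset> last D" "v \<in> last F"
proof -
  obtain k where k: "C \<in> brs B k" "length C = Suc k" using lifts_base[OF assms(1,5)] by (rule all_brsE)
  have kd: "k < depth T" using bracketsD(5)[OF liftsD(3)[OF assms(1)]] k(2) by simp
  have *: "\<forall>k<depth T. \<forall>A\<in>brs B k. \<forall>A1\<in>lifts B A. \<forall>A2\<in>lifts B A. A2 \<prec> A1 \<longrightarrow>
        (\<forall>u\<in>last A1. \<exists>A3\<in>lifts B A. A3 \<prec> A1 \<and> u \<in> last A3)"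
    using br by (simp add: bracketing_def)
  have "E \<prec> D" using assms(3) lifts_psub_iff[OF assms(2,1)] by simp
  from *[rule_format, OF kd k(1) assms(1,2) this assms(4)]
  obtain F where F: "F \<in> lifts B C" "F \<prec> D" "v \<in> last F" by blast
  show ?thesis by (rule that[OF F(1) _ F(3)]) (use F(2) lifts_psub_iff[OF F(1) assms(1)] in simp)
qed

text \<open>Take a lift through \<open>v\<close> of least size. A smaller lift inside it might miss
  \<open>v\<close>, but then (4b) supplies one that contains \<open>v\<close>, against the choice.
  So minimality among lifts through \<open>v\<close> is minimality among all lifts.\<close>

lemma minimal_lift:
  assumes "D \<in> lifts B C" "v \<in> last D" "C \<noteq> []"
  obtains E where "E \<in> lifts B C" "v \<in> last E" "last E \<subseteq> last D" "\<forall>F\<in>lifts B C. \<not> last F \<subset> last E"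
proof -
  let ?P = "\<lambda>E. E \<in> lifts B C \<and> v \<in> last E \<and> last E \<subseteq> last D"
  have "\<exists>E. ?P E \<and> (\<forall>F. ?P F \<longrightarrow> card (last E) \<le> card (last F))"
    using assms by (intro ex_has_least_nat[of ?P D]) auto
  then obtain E where E: "?P E" and least: "\<And>F. ?P F \<Longrightarrow> card (last E) \<le> card (last F)" by blast
  have "\<not> last F \<subset> last E" if F: "F \<in> lifts B C" for F
  proof
    assume "last F \<subset> last E"
    then obtain G where G: "G \<in> lifts B C" "last G \<subset> last E" "v \<in> last G"
      using lifts_refine[of E C F v] E F assms(3) by blast
    have "card (last G) < card (last E)"
      using G(2) liftsD(6) E by (intro psubset_card_mono) auto
    with least[of G] G E show False by auto
  qed
  with E that show ?thesis by blast
qed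

lemma maximal_lift:
  assumes "D \<in> lifts B C"
  obtains E where "E \<in> lifts B C" "last D \<subseteq> last E" "\<forall>F\<in>lifts B C. \<not> last E \<subset> last F"
proof -
  have "finite (last ` lifts B C)" using finite_lifts by simp
  from finite_has_maximal2[OF this imageI[OF assms]]
  obtain E where "E \<in> lifts B C" "last D \<subseteq> last E" "\<forall>X\<in>last ` lifts B C. last E \<subseteq> X \<longrightarrow> last E = X"
    by auto
  with that show ?thesis by blast
qed

lemma prec_brs: 
  assumes "(A1, A2) \<in> prec B"
  obtains k where "A1 \<in> brs B k" "A2 \<in> brs B k"
  using br assms by (auto simp: bracketing_def)

lemma prec_all_brs: "prec B \<subseteq> all_brs B \<times> all_brs B"
  by (auto simp: all_brs_def elim!: prec_brs)

lemma prec_irrefl: "(A, A) \<notin> prec B"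
  using br by (auto simp: bracketing_def irrefl_def)

lemma prec_trans: "trans (prec B)"
  using br by (simp add: bracketing_def)

lemma prec_asym: "(A1, A2) \<in> prec B \<Longrightarrow> (A2, A1) \<notin> prec B"
  using prec_irrefl prec_trans by (meson transD)

lemma comparable_iff:
  assumes "A1 \<in> brs B k" "A2 \<in> brs B k" "A1 \<noteq> A2"
  shows "comparable B A1 A2 \<longleftrightarrow> butlast A1 = butlast A2 \<and> last A1 \<inter> last A2 = {}"
proof -
  have *: "\<forall>k. \<forall>A1\<in>brs B k. \<forall>A2\<in>brs B k. A1 \<noteq> A2 \<longrightarrow>
        (comparable B A1 A2 \<longleftrightarrow> butlast A1 = butlast A2 \<and> last A1 \<inter> last A2 = {})"
    using br by (simp add: bracketing_def)
  show ?thesis by (rule *[rule_format, OF assms])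
qed

lemma prec_disjoint:
  assumes "(A1, A2) \<in> prec B"
  shows "butlast A1 = butlast A2" "last A1 \<inter> last A2 = {}"
proof -
  obtain k where "A1 \<in> brs B k" "A2 \<in> brs B k" using assms by (rule prec_brs)
  moreover have "A1 \<noteq> A2" using assms prec_irrefl by blast
  ultimately show "butlast A1 = butlast A2" "last A1 \<inter> last A2 = {}"
    using comparable_iff assms by (auto simp: comparable_def)
qed

lemma lifts_comparable:
  assumes "A1 \<in> lifts B C" "A2 \<in> lifts B C" "last A1 \<inter> last A2 = {}"
  shows "comparable B A1 A2" "A1 \<noteq> A2"
proof -
  show "A1 \<noteq> A2" using assms liftsD(5) by blast
  with comparable_iff[OF liftsD(7)[OF assms(1)] liftsD(7)[OF assms(2)]] assms liftsD(2)
  show "comparable B A1 A2" by simp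
qed

lemma prec_singletons:
  assumes "u \<in> level T k" "precedes (kids T u) u1 u2"
  shows "(singleton_bracket T (Suc k) u1, singleton_bracket T (Suc k) u2) \<in> prec B"
proof -
  have "u1 \<in> set (kids T u)" using assms(2) by (auto simp: precedes_def)
  then have "k < depth T" using level_depth[OF level_childI[OF assms(1)]] Suc_le_lessD by blast
  moreover have "\<forall>k<depth T. \<forall>u\<in>level T k. \<forall>u1 u2. precedes (kids T u) u1 u2 \<longrightarrow>
        (singleton_bracket T (Suc k) u1, singleton_bracket T (Suc k) u2) \<in> prec B"
    using br by (simp add: bracketing_def)
  ultimately show ?thesis using assms by blast
qed

lemma prec_sub:
  assumes "C' \<preceq> C" "C \<noteq> []" "C' \<noteq> []" "length C = length C'" 
    and "A1 \<in> lifts B C" "A2 \<in> lifts B C" "A1' \<in> lifts B C'" "A2' \<in> lifts B C'"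
    and "last A1 \<inter> last A2 = {}" "last A1' \<inter> last A2' = {}" "A1' \<preceq> A1" "A2' \<preceq> A2"
  shows "(A1, A2) \<in> prec B \<longleftrightarrow> (A1', A2') \<in> prec B"
proof -
  obtain k where k: "C \<in> brs B k" "length C = Suc k" using lifts_base[OF assms(5,2)] by (rule all_brsE)
  have C': "C' \<in> brs B k" using lifts_base[OF assms(7,3)] k(2) assms(4) by (simp add: brs_all_brs)
  have kd: "k < depth T" using bracketsD(5)[OF liftsD(3)[OF assms(5)]] k(2) by simp
  have *: "\<forall>k<depth T. \<forall>A\<in>brs B k. \<forall>A'\<in>brs B k. A' \<preceq> A \<longrightarrow>
        (\<forall>A1\<in>lifts B A. \<forall>A2\<in>lifts B A. \<forall>A1'\<in>lifts B A'. \<forall>A2'\<in>lifts B A'.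
           A1 \<noteq> A2 \<and> comparable B A1 A2 \<and> A1' \<noteq> A2' \<and> comparable B A1' A2' \<and>
           A1' \<preceq> A1 \<and> A2' \<preceq> A2 \<longrightarrow>
           ((A1, A2) \<in> prec B \<longleftrightarrow> (A1', A2') \<in> prec B))"
    using br by (simp add: bracketing_def)
  show ?thesis
    using *[rule_format, OF kd k(1) C' assms(1,5,6,7,8)] assms(11,12)
      lifts_comparable[OF assms(5,6,9)] lifts_comparable[OF assms(7,8,10)] by blast
qed

text \<open>\<open>A2\<close> and \<open>D\<close> share \<open>v\<close>, so they are nested, and
  (5c) with equal bases applies in one direction or the other. The position of a lift relative to
  \<open>A1\<close> thus depends on any one of its vertices.\<close>

lemma prec_cong_lifts:
  assumes "A1 \<in> lifts B C" "A2 \<in> lifts B C" "D \<in> lifts B C" "C \<noteq> []"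
    and "last A1 \<inter> last A2 = {}" "last A1 \<inter> last D = {}" "v \<in> last A2" "v \<in> last D"
  shows "(A1, A2) \<in> prec B \<longleftrightarrow> (A1, D) \<in> prec B"
proof -
  have "A2 \<preceq> D \<or> D \<preceq> A2"
    using laminar[OF liftsD(7)[OF assms(2)] liftsD(7)[OF assms(3)] assms(7,8)] .
  then show ?thesis
    using prec_sub[of C C A1 A2 A1 D] prec_sub[of C C A1 D A1 A2] assms sub_bracket_refl by blast
qed

lemma restrict_le: "bracketing_le (restrict_bracketing B S) B"
  using prec_all_brs by (auto simp: bracketing_le_def)

lemma restrict_all: "restrict_bracketing B (all_brs B) = B"
proof -
  have "brs B k \<inter> all_brs B = brs B k" for k by (auto simp: all_brs_def)
  moreover have "prec B \<inter> (all_brs B \<times> all_brs B) = prec B" using prec_all_brs by blast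
  ultimately show ?thesis by (simp add: restrict_bracketing_def)
qed

lemma bracketing_le_refl: "bracketing_le B B"
  using restrict_le[of "all_brs B"] by (simp add: restrict_all)

lemma restrict_mono: "S \<inter> all_brs B \<subseteq> S' \<Longrightarrow> bracketing_le (restrict_bracketing B S) (restrict_bracketing B S')"
  using prec_all_brs unfolding bracketing_le_def brs_restrict prec_restrict all_brs_restrict
  by (auto simp: all_brs_def)

text \<open>\<open>S\<close> is compared only within \<open>B\<close>, so it may be given by a
  predicate on arbitrary brackets, as supports are.\<close>

lemma le_eq_restrict: 
  assumes "bracketing T B'" "bracketing_le B' B" "S \<inter> all_brs B = all_brs B'"
  shows "B' = restrict_bracketing B S"
proof -
  interpret B': plane_bracketing T B' using assms by unfold_locales
  have "brs B' k = brs B k \<inter> S" for k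
    using assms(3) brs_all_brs B'.brs_all_brs by blast
  then have "brs B' = (\<lambda>k. brs B k \<inter> S)" by (rule ext)
  moreover have "prec B' = prec B \<inter> (S \<times> S)"
    using assms(2,3) prec_all_brs by (fastforce simp: bracketing_le_def)
  ultimately show ?thesis by (simp add: restrict_bracketing_def)
qed

end

section \<open>The length condition as a linear system\<close>

context plane_bracketing
begin

text \<open>Laminarity (3), the partial order and (5a), (5c) concern brackets already present and
  pass to subsets; (1) and (5b) need only the trivial brackets. What can fail is that a base or a
  lift is missing: (2), (4a) and (4b).\<close>

lemma bracketing_restrictI:
  assumes trivial: "\<And>A. \<not> nontrivial_bracket T A \<Longrightarrow> A \<in> S"
    and projection: "\<And>A k. \<lbrakk>A \<in> brs B (Suc k); A \<in> S\<rbrakk> \<Longrightarrow> butlast A \<in> S"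
    and cover: "\<And>C u v. \<lbrakk>C \<in> all_brs B; C \<in> S; u \<in> last C; v \<in> set (kids T u)\<rbrakk> \<Longrightarrow>
      \<exists>D\<in>lifts B C \<inter> S. v \<in> last D"
    and refine: "\<And>C D E v. \<lbrakk>C \<in> all_brs B; C \<in> S; D \<in> lifts B C \<inter> S; E \<in> lifts B C \<inter> S;
      last E \<subset> last D; v \<in> last D\<rbrakk> \<Longrightarrow> \<exists>F\<in>lifts B C \<inter> S. last F \<subset> last D \<and> v \<in> last F"
  shows "bracketing T (restrict_bracketing B S)"
proof -
  let ?B = "restrict_bracketing B S"
  have comp: "comparable ?B A1 A2 \<longleftrightarrow> comparable B A1 A2" if "A1 \<in> S" "A2 \<in> S" for A1 A2
    using that by (auto simp: comparable_def)
  have c1: "max_bracket T k \<in> S" if "k \<le> depth T" for k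
    by (rule trivial) (use that in \<open>auto simp: nontrivial_bracket_def is_max_bracket_def\<close>)
  have c2: "singleton_bracket T k u \<in> S" if "k \<le> depth T" "u \<in> level T k" for k u
    by (rule trivial) (use that in \<open>auto simp: nontrivial_bracket_def is_singleton_bracket_def\<close>)
  have p: "prec ?B \<subseteq> (\<Union>k. brs ?B k \<times> brs ?B k)"
    by (auto elim!: prec_brs)
  have i: "irrefl (prec ?B)" using prec_irrefl by (auto simp: irrefl_def)
  have t: "trans (prec ?B)" using prec_trans by (auto simp: trans_def)
  have lam: "A1 \<preceq> A2 \<or> A2 \<preceq> A1" if "A1 \<in> brs ?B k" "A2 \<in> brs ?B k" "last A1 \<inter> last A2 \<noteq> {}" for A1 A2 k
    using that laminar[of A1 k A2] by auto
  have cov: "(\<Union>A'\<in>lifts ?B C. last A') = (\<Union>u\<in>last C. set (kids T u))"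
    if "k < depth T" "C \<in> brs ?B k" for C k
  proof
    have "C \<in> brs B k" using that by simp
    show "(\<Union>A'\<in>lifts ?B C. last A') \<subseteq> (\<Union>u\<in>last C. set (kids T u))"
      using lifts_Union[OF \<open>C \<in> brs B k\<close> that(1)] by auto
    have "C \<in> all_brs B" "C \<in> S" using that by (auto simp: all_brs_def)
    from cover[OF this] show "(\<Union>u\<in>last C. set (kids T u)) \<subseteq> (\<Union>A'\<in>lifts ?B C. last A')"
      by auto
  qed
  have ref: "\<exists>A3\<in>lifts ?B C. A3 \<prec> A1 \<and> v \<in> last A3"
    if "C \<in> brs ?B k" "A1 \<in> lifts ?B C" "A2 \<in> lifts ?B C" "A2 \<prec> A1" "v \<in> last A1" for k C A1 A2 v
  proof -
    have C: "C \<in> all_brs B" "C \<in> S" using that(1) by (auto simp: all_brs_def)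
    have A: "A1 \<in> lifts B C \<inter> S" "A2 \<in> lifts B C \<inter> S" using that by auto
    have "last A2 \<subset> last A1" using that(4) A lifts_psub_iff[of A2 C A1] by simp
    from refine[OF C A this that(5)]
    obtain F where F: "F \<in> lifts B C \<inter> S" "last F \<subset> last A1" "v \<in> last F" by blast
    then have "F \<prec> A1" using A lifts_psub_iff[of F C A1] by simp
    with F show ?thesis by auto
  qed
  have cmp: "comparable ?B A1 A2 \<longleftrightarrow> butlast A1 = butlast A2 \<and> last A1 \<inter> last A2 = {}"
    if "A1 \<in> brs ?B k" "A2 \<in> brs ?B k" "A1 \<noteq> A2" for k A1 A2
    using that comp comparable_iff[of A1 k A2] by simp
  have sing: "(singleton_bracket T (Suc k) u1, singleton_bracket T (Suc k) u2) \<in> prec ?B"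
    if "u \<in> level T k" "precedes (kids T u) u1 u2" for k u u1 u2
  proof -
    have "u1 \<in> set (kids T u)" "u2 \<in> set (kids T u)" using that(2) by (auto simp: precedes_def)
    then have "u1 \<in> level T (Suc k)" "u2 \<in> level T (Suc k)" using that(1) level_childI by blast+
    then show ?thesis using prec_singletons[OF that] c2 level_depth by simp
  qed
  have sub: "(A1, A2) \<in> prec ?B \<longleftrightarrow> (A1', A2') \<in> prec ?B"
    if "A \<in> brs ?B k" "A' \<in> brs ?B k" "A' \<preceq> A" "A1 \<in> lifts ?B A" "A2 \<in> lifts ?B A"
      "A1' \<in> lifts ?B A'" "A2' \<in> lifts ?B A'" "A1 \<noteq> A2 \<and> comparable ?B A1 A2 \<and> A1' \<noteq> A2' \<and> comparable ?B A1' A2' \<and>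
           A1' \<preceq> A1 \<and> A2' \<preceq> A2" for k A A' A1 A2 A1' A2'
  proof -
    have "(A1, A2) \<in> prec B \<or> (A2, A1) \<in> prec B" "(A1', A2') \<in> prec B \<or> (A2', A1') \<in> prec B"
      using that(8) by (auto simp: comparable_def)
    then have "last A1 \<inter> last A2 = {}" "last A1' \<inter> last A2' = {}"
      using prec_disjoint(2) by (metis Int_commute)+
    moreover have "length A = length A'" "A \<noteq> []" "A' \<noteq> []"
      using that(1,2) by (auto simp: brs_all_brs)
    ultimately show ?thesis using prec_sub[of A' A A1 A2 A1' A2'] that by simp
  qed
  show ?thesis
    unfolding bracketing_def
    apply (intro conjI)
    subgoal using brs_brackets by auto
    subgoal by (rule p)
    subgoal by (rule i)
    subgoal by (rule t)
    subgoal using max_brs singleton_brs c1 c2 by simp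
    subgoal using butlast_brs projection by auto
    subgoal using lam by blast
    subgoal using cov by blast
    subgoal using ref by blast
    subgoal using cmp by blast
    subgoal using sing by blast
    subgoal using sub by blast
    done
qed

end

definition lift_sum :: "'v plane_tree \<Rightarrow> ('v bracket \<Rightarrow> real) \<Rightarrow> 'v bracket \<Rightarrow> 'v \<Rightarrow> real" where
  "lift_sum T l C v = (\<Sum>D\<in>{D \<in> brackets T (length C). butlast D = C \<and> v \<in> last D}. l D)"

definition balanced :: "'v plane_tree \<Rightarrow> ('v bracket \<Rightarrow> real) \<Rightarrow> bool" where
  "balanced T l \<longleftrightarrow> (\<forall>k. \<forall>C\<in>brackets T k. \<not> is_singleton_bracket T C \<longrightarrow>
     (\<forall>u\<in>last C. \<forall>v\<in>set (kids T u). l C = lift_sum T l C v))"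

text \<open>The strict inequality for nontrivial brackets is relaxed so that the set is closed and
  also contains the lengths of all smaller bracketings. Maximum brackets have no sign
  condition.\<close>

definition lengths_on :: "'v plane_tree \<Rightarrow> 'v bracketing \<Rightarrow> ('v bracket \<Rightarrow> real) set" where
  "lengths_on T B = {l. (\<forall>A. A \<notin> all_brs B \<longrightarrow> l A = 0) \<and>
     (\<forall>A. is_singleton_bracket T A \<longrightarrow> l A = 0) \<and>
     (\<forall>A. nontrivial_bracket T A \<longrightarrow> 0 \<le> l A) \<and> balanced T l}"

text \<open>Trivial brackets stay whatever their length: axiom (1) demands them, singletons have
  length 0, and a maximum bracket may.\<close>

definition support_bracketing :: "'v plane_tree \<Rightarrow> 'v bracketing \<Rightarrow> ('v bracket \<Rightarrow> real) \<Rightarrow> 'v bracketing" where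
  "support_bracketing T B l = restrict_bracketing B {A. nontrivial_bracket T A \<longrightarrow> l A \<noteq> 0}"

lemma lengths_onD:
  assumes "l \<in> lengths_on T B"
  shows "A \<notin> all_brs B \<Longrightarrow> l A = 0" "is_singleton_bracket T A \<Longrightarrow> l A = 0"
    "nontrivial_bracket T A \<Longrightarrow> 0 \<le> l A" "balanced T l"
  using assms by (auto simp: lengths_on_def)

lemma lift_sum_add: "lift_sum T (\<lambda>A. l1 A + l2 A) C v = lift_sum T l1 C v + lift_sum T l2 C v"
  by (simp add: lift_sum_def sum.distrib)

lemma lift_sum_scale: "lift_sum T (\<lambda>A. t * l A) C v = t * lift_sum T l C v"
  by (simp add: lift_sum_def sum_distrib_left)

lemma balanced_add: "\<lbrakk>balanced T l1; balanced T l2\<rbrakk> \<Longrightarrow> balanced T (\<lambda>A. l1 A + l2 A)"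
  by (simp add: balanced_def lift_sum_add)

lemma balanced_scale: "balanced T l \<Longrightarrow> balanced T (\<lambda>A. t * l A)"
  by (simp add: balanced_def lift_sum_scale)

lemma lengths_on_add: "\<lbrakk>l1 \<in> lengths_on T B; l2 \<in> lengths_on T B\<rbrakk> \<Longrightarrow> (\<lambda>A. l1 A + l2 A) \<in> lengths_on T B"
  by (simp add: lengths_on_def balanced_add)

lemma lengths_on_scale: "\<lbrakk>0 \<le> t; l \<in> lengths_on T B\<rbrakk> \<Longrightarrow> (\<lambda>A. t * l A) \<in> lengths_on T B"
  by (simp add: lengths_on_def balanced_scale)

lemma lengths_on_zero: "(\<lambda>A. 0) \<in> lengths_on T B"
  by (simp add: lengths_on_def balanced_def lift_sum_def)

section \<open>Chains of lifts, and the bracketing carried by a length\<close>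

context plane_bracketing
begin

lemma lift_sum_lifts:
  assumes "\<And>A. A \<notin> all_brs B \<Longrightarrow> l A = 0"
  shows "lift_sum T l C v = (\<Sum>D\<in>{D \<in> lifts B C. v \<in> last D}. l D)"
  unfolding lift_sum_def
proof (rule sum.mono_neutral_right)
  show "finite {D \<in> brackets T (length C). butlast D = C \<and> v \<in> last D}"
    using finite_brackets by simp
  show "{D \<in> lifts B C. v \<in> last D} \<subseteq> {D \<in> brackets T (length C). butlast D = C \<and> v \<in> last D}"
    using liftsD by auto
  show "\<forall>D\<in>{D \<in> brackets T (length C). butlast D = C \<and> v \<in> last D} - {D \<in> lifts B C. v \<in> last D}. l D = 0"
    using assms bracketsD(1) by (auto simp: lifts_def brs_all_brs)
qed

text \<open>A lift through \<open>v\<close> is nested both with \<open>A'\<close> and with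
  \<open>A\<close>; minimality of \<open>A'\<close> and maximality of \<open>A\<close> leave only
  the position between them.\<close>

lemma interval_lifts:
  assumes "A \<in> lifts B C" "A' \<in> lifts B C" "\<forall>D\<in>lifts B C. \<not> A \<prec> D" "\<forall>D\<in>lifts B C. \<not> D \<prec> A'"
    "A' \<preceq> A" "v \<in> last A'"
  shows "{D \<in> lifts B C. A' \<preceq> D \<and> D \<preceq> A} = {D \<in> lifts B C. v \<in> last D}"
proof -
  have "last A' \<subseteq> last A" using assms lifts_sub_iff by simp
  then have vA: "v \<in> last A" using assms by auto
  have "A' \<preceq> D \<and> D \<preceq> A \<longleftrightarrow> v \<in> last D" if D: "D \<in> lifts B C" for D
  proof
    assume "A' \<preceq> D \<and> D \<preceq> A"
    then show "v \<in> last D" using lifts_sub_iff[OF assms(2) D] assms(6) by auto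
  next
    assume v: "v \<in> last D"
    have "\<not> last D \<subset> last A'" "\<not> last A \<subset> last D"
      using assms(3,4) D lifts_psub_iff[OF D assms(2)] lifts_psub_iff[OF assms(1) D] by auto
    then have "last A' \<subseteq> last D" "last D \<subseteq> last A"
      using lifts_laminar[OF D assms(2) v assms(6)] lifts_laminar[OF D assms(1) v vA] by auto
    then show "A' \<preceq> D \<and> D \<preceq> A" using lifts_sub_iff[OF assms(2) D] lifts_sub_iff[OF D assms(1)] by simp
  qed
  then show ?thesis by blast
qed

text \<open>Children and maximal chains account for each other: every child \<open>v\<close> lies in
  a minimal lift, which lies in a maximal one, and every minimal lift is nonempty and consists of
  children of vertices of \<open>C\<close>.\<close>

lemma chain_sum_iff:
  assumes off: "\<And>A. A \<notin> all_brs B \<Longrightarrow> l A = 0" and C: "C \<in> all_brs B"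
  shows "(\<forall>A\<in>lifts B C. \<forall>A'\<in>lifts B C.
           (\<forall>D\<in>lifts B C. \<not> A \<prec> D) \<and> (\<forall>D\<in>lifts B C. \<not> D \<prec> A') \<and> A' \<preceq> A \<longrightarrow>
           l C = (\<Sum>D\<in>{D \<in> lifts B C. A' \<preceq> D \<and> D \<preceq> A}. l D)) \<longleftrightarrow>
         (\<forall>u\<in>last C. \<forall>v\<in>set (kids T u). l C = lift_sum T l C v)" (is "?L \<longleftrightarrow> ?R")
proof
  have C0: "C \<noteq> []" using C by (rule all_brsE) auto
  assume L: ?L
  show ?R
  proof (intro ballI)
    fix u v assume uv: "u \<in> last C" "v \<in> set (kids T u)"
    obtain D where D: "D \<in> lifts B C" "v \<in> last D" using lifts_cover[OF C uv] .
    obtain A' where A': "A' \<in> lifts B C" "v \<in> last A'" "last A' \<subseteq> last D" "\<forall>F\<in>lifts B C. \<not> last F \<subset> last A'"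
      using minimal_lift[OF D C0] .
    obtain A where A: "A \<in> lifts B C" "last A' \<subseteq> last A" "\<forall>F\<in>lifts B C. \<not> last A \<subset> last F"
      using maximal_lift[OF A'(1)] .
    have 1: "\<forall>D\<in>lifts B C. \<not> A \<prec> D" "\<forall>D\<in>lifts B C. \<not> D \<prec> A'" "A' \<preceq> A"
      using A A' lifts_psub_iff[OF A(1)] lifts_psub_iff[OF _ A'(1)] lifts_sub_iff[OF A'(1) A(1)] by auto
    with L A(1) A'(1) have "l C = (\<Sum>D\<in>{D \<in> lifts B C. A' \<preceq> D \<and> D \<preceq> A}. l D)" by blast
    also have "\<dots> = lift_sum T l C v"
      using interval_lifts[OF A(1) A'(1) 1 A'(2)] lift_sum_lifts[OF off] by simp
    finally show "l C = lift_sum T l C v" .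
  qed
next
  have C0: "C \<noteq> []" using C by (rule all_brsE) auto
  assume R: ?R
  show ?L
  proof (intro ballI impI, elim conjE)
    fix A A' assume A: "A \<in> lifts B C" "A' \<in> lifts B C" "\<forall>D\<in>lifts B C. \<not> A \<prec> D"
      "\<forall>D\<in>lifts B C. \<not> D \<prec> A'" "A' \<preceq> A"
    obtain v where v: "v \<in> last A'" using liftsD(5)[OF A(2)] by blast
    obtain u where "u \<in> last C" "v \<in> set (kids T u)" using lifts_parent[OF A(2) v C0] .
    with R have "l C = lift_sum T l C v" by blast
    then show "l C = (\<Sum>D\<in>{D \<in> lifts B C. A' \<preceq> D \<and> D \<preceq> A}. l D)"
      using interval_lifts[OF A v] lift_sum_lifts[OF off] by simp
  qed
qed

text \<open>A base outside \<open>B\<close> has no lifts in \<open>B\<close> by (2), so its equation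
  reads 0 = 0.\<close>

lemma balanced_iff:
  assumes off: "\<And>A. A \<notin> all_brs B \<Longrightarrow> l A = 0"
  shows "balanced T l \<longleftrightarrow> (\<forall>C\<in>all_brs B. \<not> is_singleton_bracket T C \<longrightarrow>
     (\<forall>u\<in>last C. \<forall>v\<in>set (kids T u). l C = lift_sum T l C v))" (is "_ \<longleftrightarrow> ?R")
proof
  assume "balanced T l"
  then show ?R using all_brs_brackets unfolding balanced_def by blast
next
  assume R: ?R
  show "balanced T l"
    unfolding balanced_def
  proof (intro allI ballI impI)
    fix k C u v
    assume C: "C \<in> brackets T k" "\<not> is_singleton_bracket T C" and uv: "u \<in> last C" "v \<in> set (kids T u)"
    show "l C = lift_sum T l C v"
    proof (cases "C \<in> all_brs B")
      case True
      with R C uv show ?thesis by blast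
    next
      case False
      then have "lifts B C = {}" using lifts_base bracketsD(2)[OF C(1)] by blast
      then show ?thesis using off[OF False] lift_sum_lifts[of l C v] off by simp
    qed
  qed
qed

lemma metric_bracketing_iff:
  "metric_bracketing T (B, l) \<longleftrightarrow>
     l \<in> lengths_on T B \<and> (\<forall>A\<in>all_brs B. nontrivial_bracket T A \<longrightarrow> 0 < l A)"
proof (cases "\<forall>A. A \<notin> all_brs B \<longrightarrow> l A = 0")
  case True
  then have off: "\<And>A. A \<notin> all_brs B \<Longrightarrow> l A = 0" by blast
  have b: "balanced T l \<longleftrightarrow> (\<forall>C\<in>all_brs B. \<not> is_singleton_bracket T C \<longrightarrow>
     (\<forall>u\<in>last C. \<forall>v\<in>set (kids T u). l C = lift_sum T l C v))"
    by (rule balanced_iff) (rule off)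
  have c: "(\<forall>A\<in>lifts B C. \<forall>A'\<in>lifts B C.
           (\<forall>D\<in>lifts B C. \<not> A \<prec> D) \<and> (\<forall>D\<in>lifts B C. \<not> D \<prec> A') \<and> A' \<preceq> A \<longrightarrow>
           l C = (\<Sum>D\<in>{D \<in> lifts B C. A' \<preceq> D \<and> D \<preceq> A}. l D)) \<longleftrightarrow>
         (\<forall>u\<in>last C. \<forall>v\<in>set (kids T u). l C = lift_sum T l C v)" if "C \<in> all_brs B" for C
    by (rule chain_sum_iff[OF _ that]) (rule off)
  have "balanced T l \<longleftrightarrow> (\<forall>C\<in>all_brs B. \<not> is_singleton_bracket T C \<longrightarrow>
        (\<forall>A\<in>lifts B C. \<forall>A'\<in>lifts B C.
           (\<forall>D\<in>lifts B C. \<not> A \<prec> D) \<and> (\<forall>D\<in>lifts B C. \<not> D \<prec> A') \<and> A' \<preceq> A \<longrightarrow>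
           l C = (\<Sum>D\<in>{D \<in> lifts B C. A' \<preceq> D \<and> D \<preceq> A}. l D)))"
    unfolding b by (intro ball_cong imp_cong refl c[symmetric])
  then have "metric_bracketing T (B, l) \<longleftrightarrow> (\<forall>A. is_singleton_bracket T A \<longrightarrow> l A = 0) \<and>
     (\<forall>A\<in>all_brs B. nontrivial_bracket T A \<longrightarrow> l A > 0) \<and> balanced T l"
    unfolding metric_bracketing_def prod.case using br True by argo
  moreover have "0 \<le> l A" if "\<forall>A\<in>all_brs B. nontrivial_bracket T A \<longrightarrow> l A > 0" "nontrivial_bracket T A" for A
    using off that by (cases "A \<in> all_brs B") force+
  ultimately show ?thesis using True unfolding lengths_on_def by blast
qed (auto simp: metric_bracketing_def lengths_on_def)

lemma lengths_on_mono:
  assumes "bracketing_le B' B"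
  shows "lengths_on T B' \<subseteq> lengths_on T B"
  using bracketing_le_all_brs[OF assms] unfolding lengths_on_def by blast

lemma lifts_nontrivial:
  assumes "D \<in> lifts B C" "C \<noteq> []"
  shows "\<not> is_singleton_bracket T C \<Longrightarrow> \<not> is_singleton_bracket T D"
    and "\<not> is_max_bracket T C \<Longrightarrow> \<not> is_max_bracket T D"
proof -
  obtain k where k: "length C = Suc k" using assms(2) by (cases C) auto
  have D: "butlast D = C" "length D = Suc (Suc k)"
    using liftsD(2)[OF assms(1)] bracketsD(1)[OF liftsD(3)[OF assms(1)]] k by auto
  show "\<not> is_singleton_bracket T C \<Longrightarrow> \<not> is_singleton_bracket T D"
    using is_singleton_bracket_butlast[of D k] D by auto
  show "\<not> is_max_bracket T C \<Longrightarrow> \<not> is_max_bracket T D"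
    using is_max_bracket_butlast[of D k] D by auto
qed

text \<open>A maximum bracket has the whole level as top component, which no lift of the same base
  can exceed. Sums over lifts strictly inside \<open>D\<close> therefore have no terms of
  uncontrolled sign.\<close>

lemma psub_not_max:
  assumes "D \<in> lifts B C" "E \<in> lifts B C" "last E \<subset> last D" 
  shows "\<not> is_max_bracket T E"
proof
  assume "is_max_bracket T E"
  then obtain k where "E = max_bracket T k" by (auto simp: is_max_bracket_def)
  moreover have "length E = Suc (length C)" using bracketsD(1)[OF liftsD(3)[OF assms(2)]] .
  ultimately have "last E = level T (length C)" by auto
  then have "last D \<subseteq> last E" using bracketsD(3)[OF liftsD(3)[OF assms(1)]] by simp
  with assms(3) show False by blast
qed

text \<open>Singleton bases are exempt from the length condition; over them the singleton of
  \<open>v\<close> serves for (4a) and (4b) instead.\<close>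

lemma singleton_lift:
  assumes "is_singleton_bracket T C" "C \<in> all_brs B" "u \<in> last C" "v \<in> set (kids T u)"
  obtains D where "D \<in> lifts B C" "last D = {v}" "is_singleton_bracket T D"
proof -
  obtain k w where C: "w \<in> level T k" "C = singleton_bracket T k w"
    using assms(1) by (auto simp: is_singleton_bracket_def)
  then have "w = u" using assms(3) last_singleton_bracket by auto
  let ?D = "singleton_bracket T (Suc k) v"
  have v: "v \<in> level T (Suc k)" using C(1) assms(4) \<open>w = u\<close> level_childI by simp
  have "butlast ?D = C" using butlast_singleton_bracket C assms(4) \<open>w = u\<close> by simp
  moreover have "?D \<in> brs B (length C)" using singleton_brs[OF v] C by simp
  ultimately have "?D \<in> lifts B C" by (simp add: lifts_def)
  moreover have "is_singleton_bracket T ?D"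
    using v level_depth[OF v] by (auto simp: is_singleton_bracket_def)
  ultimately show ?thesis using that last_singleton_bracket[OF v] by blast
qed

lemma lengths_on_nonneg:
  assumes "l \<in> lengths_on T B" "\<not> is_max_bracket T A"
  shows "0 \<le> l A"
  using lengths_onD(2,3)[OF assms(1)] assms(2) by (cases "is_singleton_bracket T A") (auto simp: nontrivial_bracket_def)

lemma length_eq_lift_sum:
  assumes "l \<in> lengths_on T B" "C \<in> all_brs B" "\<not> is_singleton_bracket T C" "u \<in> last C" "v \<in> set (kids T u)"
  shows "l C = (\<Sum>D\<in>{D \<in> lifts B C. v \<in> last D}. l D)"
proof -
  have "l C = lift_sum T l C v"
    using balanced_iff[of l] lengths_onD(1,4)[OF assms(1)] assms by blast
  also have "\<dots> = (\<Sum>D\<in>{D \<in> lifts B C. v \<in> last D}. l D)"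
    by (rule lift_sum_lifts) (rule lengths_onD(1)[OF assms(1)])
  finally show ?thesis .
qed

text \<open>
  Subtracting the part of the chain through \<open>v\<close> that contains \<open>D\<close> shows that the total length of
  the lifts strictly inside \<open>D\<close> does not depend on \<open>v\<close>.
\<close>

lemma sum_strictly_inside:
  assumes "l \<in> lengths_on T B" "C \<in> all_brs B" "\<not> is_singleton_bracket T C" "D \<in> lifts B C" "v \<in> last D"
  shows "(\<Sum>F\<in>{F \<in> lifts B C. v \<in> last F \<and> last F \<subset> last D}. l F) =
    l C - (\<Sum>F\<in>{F \<in> lifts B C. last D \<subseteq> last F}. l F)"
proof -
  have "C \<noteq> []" using assms(2) by (rule all_brsE) auto
  with lifts_parent[OF assms(4,5)] obtain u where u: "u \<in> last C" "v \<in> set (kids T u)" .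
  let ?X = "{F \<in> lifts B C. v \<in> last F \<and> last F \<subset> last D}" and ?Y = "{F \<in> lifts B C. last D \<subseteq> last F}"
  have "{F \<in> lifts B C. v \<in> last F} = ?X \<union> ?Y"
    using lifts_laminar[OF assms(4) _ assms(5)] assms(5) by blast
  moreover have "?X \<inter> ?Y = {}" by blast
  ultimately have "l C = sum l ?X + sum l ?Y"
    using length_eq_lift_sum[OF assms(1-3) u] finite_lifts[of C] by (simp add: sum.union_disjoint)
  then show ?thesis by simp
qed

text \<open>For (2), a positive lift is one term of a sum of nonnegative terms equal to the length
  of its nontrivial base. For (4a), a nonzero base length forces a nonzero term in the sum for every
  child. For (4b), the total strictly inside \<open>D\<close> is the same at every vertex of
  \<open>D\<close>.\<close>

lemma bracketing_support:
  assumes l: "l \<in> lengths_on T B"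
  shows "bracketing T (support_bracketing T B l)"
  unfolding support_bracketing_def
proof (rule bracketing_restrictI)
  let ?S = "{A. nontrivial_bracket T A \<longrightarrow> l A \<noteq> 0}"
  show "A \<in> ?S" if "\<not> nontrivial_bracket T A" for A using that by simp
  show "butlast A \<in> ?S" if A: "A \<in> brs B (Suc k)" "A \<in> ?S" for A k
  proof (cases "nontrivial_bracket T (butlast A)")
    case True
    let ?C = "butlast A"
    have lA: "length A = Suc (Suc k)" and "A \<in> brackets T (Suc k)" using A brs_brackets bracketsD(1) by blast+
    then obtain v where v: "v \<in> last A" using bracketsD(4) by blast
    have lift: "A \<in> lifts B ?C" using A lA by (simp add: lifts_def)
    have C0: "?C \<noteq> []" using lA by (metis length_butlast diff_Suc_1 length_0_conv nat.distinct(1))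
    obtain u where u: "u \<in> last ?C" "v \<in> set (kids T u)" using lifts_parent[OF lift v C0] .
    have C: "?C \<in> all_brs B" using lifts_base[OF lift C0] .
    have nsing: "\<not> is_singleton_bracket T ?C" and nmax: "\<not> is_max_bracket T ?C"
      using True by (auto simp: nontrivial_bracket_def)
    have "l A \<noteq> 0" using A(2) lifts_nontrivial[OF lift C0] nsing nmax by (auto simp: nontrivial_bracket_def)
    moreover have nn: "0 \<le> l D" if "D \<in> lifts B ?C" for D
      using lengths_on_nonneg[OF l] lifts_nontrivial(2)[OF that C0] nmax by blast
    ultimately have "0 < l A" using nn[OF lift] by simp
    also have "l A \<le> (\<Sum>D\<in>{D \<in> lifts B ?C. v \<in> last D}. l D)"
      using lift v nn finite_lifts by (intro member_le_sum) auto
    also have "\<dots> = l ?C" using length_eq_lift_sum[OF l C nsing u] by simp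
    finally show ?thesis by simp
  qed simp
  show "\<exists>D\<in>lifts B C \<inter> ?S. v \<in> last D"
    if C: "C \<in> all_brs B" "C \<in> ?S" and uv: "u \<in> last C" "v \<in> set (kids T u)" for C u v
  proof -
    obtain k where k: "C \<in> brs B k" "C \<in> brackets T k" using C(1) by (rule all_brsE) blast
    have v: "v \<in> level T (Suc k)" using level_childI uv bracketsD(3)[OF k(2)] by blast
    consider "is_singleton_bracket T C" | "is_max_bracket T C" | "nontrivial_bracket T C"
      by (auto simp: nontrivial_bracket_def)
    then show ?thesis
    proof cases
      case 1
      obtain D where "D \<in> lifts B C" "last D = {v}" "is_singleton_bracket T D"
        using singleton_lift[OF 1 C(1) uv] .
      then show ?thesis by (auto simp: nontrivial_bracket_def)
    next
      case 2
      \<comment> \<open>A maximum base may have length 0, so its equation need not yield a lift; the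
        next maximum bracket is retained anyway and contains every \<open>v\<close>.\<close>
      let ?D = "max_bracket T (Suc k)"
      have "C = max_bracket T k" using 2 bracketsD(1)[OF k(2)] by (auto simp: is_max_bracket_def)
      then have "?D \<in> lifts B C" using max_brs[OF level_depth[OF v]] by (simp add: lifts_def)
      moreover have "is_max_bracket T ?D" using level_depth[OF v] by (auto simp: is_max_bracket_def)
      ultimately show ?thesis using v by (intro bexI[of _ ?D]) (auto simp: nontrivial_bracket_def)
    next
      case 3
      then have "l C \<noteq> 0" "\<not> is_singleton_bracket T C" using C(2) by (auto simp: nontrivial_bracket_def)
      then have "(\<Sum>D\<in>{D \<in> lifts B C. v \<in> last D}. l D) \<noteq> 0"
        using length_eq_lift_sum[OF l C(1) _ uv] by simp
      then obtain D where "D \<in> {D \<in> lifts B C. v \<in> last D}" "l D \<noteq> 0" by (rule sum.not_neutral_contains_not_neutral)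
      then show ?thesis by auto
    qed
  qed
  show "\<exists>F\<in>lifts B C \<inter> ?S. last F \<subset> last D \<and> v \<in> last F"
    if C: "C \<in> all_brs B" "C \<in> ?S" and D: "D \<in> lifts B C \<inter> ?S" and E: "E \<in> lifts B C \<inter> ?S"
      and ED: "last E \<subset> last D" and v: "v \<in> last D" for C D E v
  proof -
    have C0: "C \<noteq> []" using C(1) by (rule all_brsE) auto
    have D': "D \<in> lifts B C" and E': "E \<in> lifts B C" using D E by auto
    show ?thesis
    proof (cases "is_singleton_bracket T C")
      \<comment> \<open>There is no equation over a singleton base. The lift \<open>{v}\<close> is
        smaller than \<open>D\<close>, because \<open>D\<close> has a nonempty proper sublift and
        hence more than one vertex.\<close>
      case True
      obtain u where u: "u \<in> last C" "v \<in> set (kids T u)" using lifts_parent[OF D' v C0] .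
      obtain F where F: "F \<in> lifts B C" "last F = {v}" "is_singleton_bracket T F"
        using singleton_lift[OF True C(1) u] .
      have "last D \<noteq> {v}" using ED liftsD(5)[OF E'] by (auto simp: subset_singleton_iff)
      then have "last F \<subset> last D" using F(2) v by auto
      with F show ?thesis by (intro bexI[of _ F]) (auto simp: nontrivial_bracket_def)
    next
      case False
      let ?X = "\<lambda>v. {F \<in> lifts B C. v \<in> last F \<and> last F \<subset> last D}"
      \<comment> \<open>At \<open>w\<close> the total strictly inside \<open>D\<close> is positive
        because of \<open>E\<close>; by \<open>sum_strictly_inside\<close> it is the same at
        \<open>v\<close>, so some lift through \<open>v\<close> there has nonzero length.\<close>
      obtain w where w: "w \<in> last E" using liftsD(5)[OF E'] by blast
      have nn: "0 \<le> l F" if "F \<in> ?X w" for F w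
        using that psub_not_max[OF D', of F] lengths_on_nonneg[OF l] by blast
      have "nontrivial_bracket T E"
        using psub_not_max[OF D' E' ED] lifts_nontrivial(1)[OF E' C0 False] by (simp add: nontrivial_bracket_def)
      then have "0 < l E" using E lengths_onD(3)[OF l, of E] by auto
      also have "l E \<le> sum l (?X w)"
        using nn finite_lifts w ED E' by (intro member_le_sum) auto
      also have "\<dots> = sum l (?X v)"
        using sum_strictly_inside[OF l C(1) False D', of v] sum_strictly_inside[OF l C(1) False D', of w] v w ED
        by auto
      finally have "sum l (?X v) \<noteq> 0" by simp
      then obtain F where "F \<in> ?X v" "l F \<noteq> 0" by (rule sum.not_neutral_contains_not_neutral)
      then show ?thesis by blast
    qed
  qed
qed

lemma support_le: "bracketing_le (support_bracketing T B l) B"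
  unfolding support_bracketing_def by (rule restrict_le)

lemma all_brs_support:
  "all_brs (support_bracketing T B l) = {A \<in> all_brs B. nontrivial_bracket T A \<longrightarrow> l A \<noteq> 0}"
  by (auto simp: support_bracketing_def)

lemma metric_support:
  assumes "l \<in> lengths_on T B"
  shows "metric_bracketing T (support_bracketing T B l, l)"
proof -
  interpret S: plane_bracketing T "support_bracketing T B l"
    using bracketing_support[OF assms] by unfold_locales
  have "l A = 0" if "A \<notin> all_brs (support_bracketing T B l)" for A
    using that lengths_onD(1)[OF assms] by (auto simp: all_brs_support)
  then have "l \<in> lengths_on T (support_bracketing T B l)"
    using assms by (simp add: lengths_on_def)
  moreover have "0 < l A" if "A \<in> all_brs (support_bracketing T B l)" "nontrivial_bracket T A" for A
    using that lengths_onD(3)[OF assms that(2)] by (auto simp: all_brs_support)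
  ultimately show ?thesis by (simp add: S.metric_bracketing_iff)
qed

lemma metric_eq_support:
  assumes m: "metric_bracketing T (B', l)" and le: "bracketing_le B' B"
  shows "l \<in> lengths_on T B" "B' = support_bracketing T B l"
proof -
  have br': "bracketing T B'" using m by (simp add: metric_bracketing_def)
  interpret B': plane_bracketing T B' using br' by unfold_locales
  have l: "l \<in> lengths_on T B'" and pos: "\<forall>A\<in>all_brs B'. nontrivial_bracket T A \<longrightarrow> 0 < l A"
    using m B'.metric_bracketing_iff by auto
  show "l \<in> lengths_on T B" using l lengths_on_mono[OF le] by blast
  have "{A. nontrivial_bracket T A \<longrightarrow> l A \<noteq> 0} \<inter> all_brs B = all_brs B'"
    using bracketing_le_all_brs[OF le] pos lengths_onD(1)[OF l] B'.trivial_brs by fastforce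
  from le_eq_restrict[OF br' le this] show "B' = support_bracketing T B l"
    by (simp add: support_bracketing_def)
qed

lemma tau_met_eq: "tau_met T B = (\<lambda>l. (support_bracketing T B l, l)) ` lengths_on T B"
proof
  show "tau_met T B \<subseteq> (\<lambda>l. (support_bracketing T B l, l)) ` lengths_on T B"
    using metric_eq_support by (fastforce simp: tau_met_def cat_assoc_def)
  show "(\<lambda>l. (support_bracketing T B l, l)) ` lengths_on T B \<subseteq> tau_met T B"
    using metric_support support_le by (auto simp: tau_met_def cat_assoc_def)
qed

end

section \<open>Joins and faces\<close>

lemma carrier_cat_assoc [simp]: "carrier (cat_assoc T) = {B. bracketing T B}"
  by (simp add: cat_assoc_def)

lemma le_cat_assoc [simp]: "B1 \<sqsubseteq>\<^bsub>cat_assoc T\<^esub> B2 \<longleftrightarrow> bracketing_le B1 B2"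
  by (simp add: cat_assoc_def)

lemma least_cat_assoc_unique:
  assumes "least (cat_assoc T) x A" "least (cat_assoc T) y A"
  shows "x = y"
  using assms bracketing_le_antisym by (fastforce simp: least_def)

text \<open>\<open>join\<close> selects some least upper bound, and antisymmetry makes it unique.
  Only individual joins are computed this way, since a pair of bracketings need not have a common
  upper bound.\<close>

lemma join_cat_assoc_eqI:
  assumes "bracketing T B1" "bracketing T B2" "bracketing T J" "bracketing_le B1 J" "bracketing_le B2 J"
    and "\<And>U. \<lbrakk>bracketing T U; bracketing_le B1 U; bracketing_le B2 U\<rbrakk> \<Longrightarrow> bracketing_le J U"
  shows "B1 \<squnion>\<^bsub>cat_assoc T\<^esub> B2 = J"
proof -
  have "least (cat_assoc T) J (Upper (cat_assoc T) {B1, B2})"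
    using assms by (auto simp: least_def Upper_def)
  then show ?thesis
    unfolding join_def sup_def using least_cat_assoc_unique by (intro some_equality)
qed

lemma bottom_cat_assoc_eqI:
  assumes "bracketing T J" "\<And>U. bracketing T U \<Longrightarrow> bracketing_le J U"
  shows "\<bottom>\<^bsub>cat_assoc T\<^esub> = J"
proof -
  have "least (cat_assoc T) J (carrier (cat_assoc T))"
    using assms by (auto simp: least_def)
  then show ?thesis
    unfolding bottom_def using least_cat_assoc_unique by (intro some_equality)
qed

section \<open>Order relations shared by all upper bounds\<close>

context rooted_plane_tree
begin

text \<open>
  Two brackets contributed by different bracketings are compared by (5c) through a lift of the
  same base in the first bracketing that meets the second bracket but not the first one.
\<close>

lemma prec_common_upper:
  assumes br: "bracketing T B1" "bracketing T B2" "bracketing T U" "bracketing T U'"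
    and le: "bracketing_le B1 U" "bracketing_le B2 U" "bracketing_le B1 U'" "bracketing_le B2 U'"
    and A: "A1 \<in> all_brs B1" "A2 \<in> all_brs B2" "(A1, A2) \<in> prec U"
  shows "(A1, A2) \<in> prec U'"
proof -
  interpret B1: plane_bracketing T B1 using br by unfold_locales
  interpret U: plane_bracketing T U using br by unfold_locales
  interpret U': plane_bracketing T U' using br by unfold_locales
  let ?C = "butlast A1"
  have disj: "butlast A2 = ?C" "last A1 \<inter> last A2 = {}" using U.prec_disjoint[OF A(3)] by auto
  obtain k where k: "A1 \<in> brs U k" "A2 \<in> brs U k" using A(3) by (rule U.prec_brs)
  have A1: "A1 \<in> brackets T k" and A2: "A2 \<in> brackets T k" using k U.brs_brackets by blast+
  have "k \<noteq> 0"
  proof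
    assume "k = 0"
    then have "last A1 = {root T}" "last A2 = {root T}"
      using bracketsD(3,4)[OF A1] bracketsD(3,4)[OF A2] level_0 by auto
    with disj show False by simp
  qed
  then obtain j where j: "k = Suc j" by (cases k) auto
  have len: "length A1 = Suc k" "length A2 = Suc k" using A1 A2 bracketsD(1) by blast+
  then have lC: "length ?C = k" by simp
  with j have C0: "?C \<noteq> []" by (metis length_0_conv nat.distinct(1))
  have AB: "A1 \<in> lifts B1 ?C" using A(1) len lC by (simp add: lifts_def B1.brs_all_brs)
  have AU: "A1 \<in> lifts U ?C" "A2 \<in> lifts U ?C" using k lC disj by (auto simp: lifts_def)
  have "A1 \<in> all_brs U'" "A2 \<in> all_brs U'"
    using A(1,2) bracketing_le_all_brs[OF le(3)] bracketing_le_all_brs[OF le(4)] by blast+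
  then have AU': "A1 \<in> lifts U' ?C" "A2 \<in> lifts U' ?C"
    using len lC disj(1) by (auto simp: lifts_def U'.brs_all_brs)
  obtain v where v: "v \<in> last A2" using bracketsD(4)[OF A2] by blast
  obtain u where u: "u \<in> last ?C" "v \<in> set (kids T u)" using U.lifts_parent[OF AU(2) v C0] .
  obtain D' where D': "D' \<in> lifts B1 ?C" "v \<in> last D'"
    using B1.lifts_cover[OF B1.lifts_base[OF AB C0] u] .
  obtain D where D: "D \<in> lifts B1 ?C" "v \<in> last D" "\<forall>F\<in>lifts B1 ?C. \<not> last F \<subset> last D"
    using B1.minimal_lift[OF D' C0] by metis
  have DU: "D \<in> lifts U ?C" "D \<in> lifts U' ?C"
    using D(1) bracketing_le_lifts[OF le(1)] bracketing_le_lifts[OF le(3)] by auto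
  have A1D: "last A1 \<inter> last D = {}"
  proof (rule ccontr)
    assume "last A1 \<inter> last D \<noteq> {}"
    then have "last A1 \<subseteq> last D \<or> last D \<subseteq> last A1" using B1.lifts_laminar[OF AB D(1)] by blast
    moreover have "\<not> last D \<subseteq> last A1" using D(2) v disj(2) by blast
    ultimately show False using D(3) AB by blast
  qed
  \<comment> \<open>\<open>D\<close> replaces \<open>A2\<close>: both \<open>A1\<close> and
    \<open>D\<close> belong to \<open>B1\<close>, where \<open>U\<close> and \<open>U'\<close> have
    the same order, and \<open>D\<close> meets \<open>A2\<close> in \<open>v\<close>.\<close>
  have "(A1, D) \<in> prec U" using U.prec_cong_lifts[OF AU DU(1) C0 disj(2) A1D v D(2)] A(3) by simp
  then have "(A1, D) \<in> prec U'"
    using bracketing_le_prec[OF le(1), of A1 D] bracketing_le_prec[OF le(3), of A1 D] A(1) B1.liftsD(1)[OF D(1)]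
    by simp
  then show ?thesis using U'.prec_cong_lifts[OF AU' DU(2) C0 disj(2) A1D v D(2)] by simp
qed

text \<open>Related brackets have disjoint top components, so neither is maximum. Both are then
  singletons of siblings, whose order (5b) dictates; the opposite order is excluded by
  asymmetry.\<close>

lemma prec_trivial:
  assumes br: "bracketing T U" "bracketing T U'"
    and A: "\<not> nontrivial_bracket T A1" "\<not> nontrivial_bracket T A2" "(A1, A2) \<in> prec U"
  shows "(A1, A2) \<in> prec U'"
proof -
  interpret U: plane_bracketing T U using br by unfold_locales
  interpret U': plane_bracketing T U' using br by unfold_locales
  have disj: "butlast A1 = butlast A2" "last A1 \<inter> last A2 = {}" using U.prec_disjoint[OF A(3)] by auto
  obtain k where k: "A1 \<in> brs U k" "A2 \<in> brs U k" using A(3) by (rule U.prec_brs)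
  have A1: "A1 \<in> brackets T k" and A2: "A2 \<in> brackets T k" using k U.brs_brackets by blast+
  have "last A1 \<noteq> level T k" "last A2 \<noteq> level T k"
    using disj(2) bracketsD(3,4)[OF A1] bracketsD(3,4)[OF A2] by auto
  then have "\<not> is_max_bracket T A1" "\<not> is_max_bracket T A2"
    using bracketsD(1)[OF A1] bracketsD(1)[OF A2] by (auto simp: is_max_bracket_def)
  then have "is_singleton_bracket T A1" "is_singleton_bracket T A2"
    using A by (auto simp: nontrivial_bracket_def)
  then obtain u1 u2 where u: "u1 \<in> level T k" "A1 = singleton_bracket T k u1"
      "u2 \<in> level T k" "A2 = singleton_bracket T k u2"
    using bracketsD(1)[OF A1] bracketsD(1)[OF A2] by (auto simp: is_singleton_bracket_def)
  have ne: "u1 \<noteq> u2" using disj u last_singleton_bracket by auto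
  have "k \<noteq> 0" using ne u(1,3) level_0 by (metis singletonD)
  then obtain j where j: "k = Suc j" by (cases k) auto
  obtain w1 w2 where w: "w1 \<in> level T j" "u1 \<in> set (kids T w1)" "w2 \<in> level T j" "u2 \<in> set (kids T w2)"
    using u j level_kids by auto
  have "singleton_bracket T j w1 = singleton_bracket T j w2"
    using disj(1) unfolding u(2,4) j butlast_singleton_bracket[OF w(1,2)] butlast_singleton_bracket[OF w(3,4)] .
  from arg_cong[OF this, of last] have "w1 = w2"
    unfolding last_singleton_bracket[OF w(1)] last_singleton_bracket[OF w(3)] by (rule singleton_inject)
  then obtain i1 i2 where i: "i1 < length (kids T w1)" "kids T w1 ! i1 = u1"
      "i2 < length (kids T w1)" "kids T w1 ! i2 = u2"
    using w by (auto simp: in_set_conv_nth)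
  then have "i1 < i2 \<or> i2 < i1" using ne by (cases i1 i2 rule: linorder_cases) auto
  then have "precedes (kids T w1) u1 u2 \<or> precedes (kids T w1) u2 u1"
    using i unfolding precedes_def by blast
  moreover have "\<not> precedes (kids T w1) u2 u1"
    using U.prec_singletons[OF w(1), of u2 u1] U.prec_asym A(3) u(2,4) j by auto
  ultimately show ?thesis using U'.prec_singletons[OF w(1)] u(2,4) j by auto
qed

end

lemma met_space_simps [simp]:
  "carrier (met_space T) = {x. metric_bracketing T x}"
  "\<zero>\<^bsub>met_space T\<^esub> = (\<bottom>\<^bsub>cat_assoc T\<^esub>, \<lambda>A. 0)"
  "(B1, l1) \<oplus>\<^bsub>met_space T\<^esub> (B2, l2) = (B1 \<squnion>\<^bsub>cat_assoc T\<^esub> B2, \<lambda>A. l1 A + l2 A)"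
  "t \<odot>\<^bsub>met_space T\<^esub> (B, l) = (if t = 0 then (\<bottom>\<^bsub>cat_assoc T\<^esub>, \<lambda>A. 0) else (B, \<lambda>A. t * l A))"
  by (simp_all add: met_space_def)

section \<open>The semimodule operations in terms of lengths\<close>

context plane_bracketing
begin

definition metric_of :: "('v bracket \<Rightarrow> real) \<Rightarrow> 'v metric_bracketing" where
  "metric_of l = (support_bracketing T B l, l)"

lemma fst_metric_of [simp]: "fst (metric_of l) = support_bracketing T B l"
  and snd_metric_of [simp]: "snd (metric_of l) = l"
  by (simp_all add: metric_of_def)

lemma tau_met_metric_of: "tau_met T B = metric_of ` lengths_on T B"
  unfolding tau_met_eq metric_of_def ..

lemma support_mono:
  assumes "\<And>A. \<lbrakk>A \<in> all_brs B; nontrivial_bracket T A; l1 A \<noteq> 0\<rbrakk> \<Longrightarrow> l2 A \<noteq> 0"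
  shows "bracketing_le (support_bracketing T B l1) (support_bracketing T B l2)"
  unfolding support_bracketing_def by (rule restrict_mono) (use assms in auto)

text \<open>Nontrivial lengths are nonnegative and cannot cancel, so the brackets of the sum are the
  union of those of the summands. Leastness is the harder half: an upper bound \<open>U\<close> need
  not be related to \<open>B\<close>, yet it must order this union in the same way.\<close>

lemma support_join:
  assumes l: "l1 \<in> lengths_on T B" "l2 \<in> lengths_on T B"
  shows "support_bracketing T B l1 \<squnion>\<^bsub>cat_assoc T\<^esub> support_bracketing T B l2 =
    support_bracketing T B (\<lambda>A. l1 A + l2 A)" (is "?B1 \<squnion>\<^bsub>_\<^esub> ?B2 = ?J")
proof -
  have sum0: "l1 A + l2 A \<noteq> 0 \<longleftrightarrow> l1 A \<noteq> 0 \<or> l2 A \<noteq> 0" if "nontrivial_bracket T A" for A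
    using lengths_onD(3)[OF l(1) that] lengths_onD(3)[OF l(2) that] by linarith
  have le: "bracketing_le ?B1 ?J" "bracketing_le ?B2 ?J"
    using sum0 by (auto intro!: support_mono)
  have all: "all_brs ?J = all_brs ?B1 \<union> all_brs ?B2"
    using sum0 by (auto simp: all_brs_support)
  have br1: "bracketing T ?B1" and br2: "bracketing T ?B2" and brJ: "bracketing T ?J"
    using bracketing_support l lengths_on_add by blast+
  show ?thesis
  proof (rule join_cat_assoc_eqI[OF br1 br2 brJ le])
    fix U assume U: "bracketing T U" "bracketing_le ?B1 U" "bracketing_le ?B2 U"
    interpret B1: plane_bracketing T ?B1 using br1 by unfold_locales
    interpret B2: plane_bracketing T ?B2 using br2 by unfold_locales
    interpret J: plane_bracketing T ?J using brJ by unfold_locales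
    \<comment> \<open>Stated symmetrically in the upper bounds \<open>V\<close> and
      \<open>V'\<close>, to be applied from the sum to \<open>U\<close> and back. Pairs within one
      summand are immediate; mixed pairs use \<open>prec_common_upper\<close>.\<close>
    have transfer: "(A1, A2) \<in> prec V'"
      if "(A1, A2) \<in> prec V" "A1 \<in> all_brs ?J" "A2 \<in> all_brs ?J" "bracketing T V" "bracketing T V'"
        "bracketing_le ?B1 V" "bracketing_le ?B2 V" "bracketing_le ?B1 V'" "bracketing_le ?B2 V'" for A1 A2 V V'
    proof -
      have "A1 \<in> all_brs ?B1 \<or> A1 \<in> all_brs ?B2" "A2 \<in> all_brs ?B1 \<or> A2 \<in> all_brs ?B2"
        using that(2,3) by (simp_all only: all Un_iff)
      then consider "A1 \<in> all_brs ?B1" "A2 \<in> all_brs ?B1" | "A1 \<in> all_brs ?B1" "A2 \<in> all_brs ?B2"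
        | "A1 \<in> all_brs ?B2" "A2 \<in> all_brs ?B1" | "A1 \<in> all_brs ?B2" "A2 \<in> all_brs ?B2"
        by blast
      then show ?thesis
      proof cases
        case 1
        then show ?thesis using bracketing_le_prec[OF that(6) 1] bracketing_le_prec[OF that(8) 1] that(1) by simp
      next
        case 2
        then show ?thesis by (rule prec_common_upper[OF br1 br2 that(4,5,6,7,8,9) _ _ that(1)])
      next
        case 3
        then show ?thesis by (rule prec_common_upper[OF br2 br1 that(4,5,7,6,9,8) _ _ that(1)])
      next
        case 4
        then show ?thesis using bracketing_le_prec[OF that(7) 4] bracketing_le_prec[OF that(9) 4] that(1) by simp
      qed
    qed
    have "brs ?J k \<subseteq> brs U k" for k
      using J.brs_all_brs B1.brs_all_brs B2.brs_all_brs all U(2,3) unfolding bracketing_le_def by blast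
    moreover have "prec ?J = prec U \<inter> (all_brs ?J \<times> all_brs ?J)"
    proof (intro equalityI subrelI)
      fix A1 A2 assume A: "(A1, A2) \<in> prec ?J"
      then have "A1 \<in> all_brs ?J" "A2 \<in> all_brs ?J" using J.prec_all_brs by auto
      with transfer[OF A this brJ U(1) le U(2,3)]
      show "(A1, A2) \<in> prec U \<inter> (all_brs ?J \<times> all_brs ?J)" by blast
    next
      fix A1 A2 assume "(A1, A2) \<in> prec U \<inter> (all_brs ?J \<times> all_brs ?J)"
      then show "(A1, A2) \<in> prec ?J" using transfer[OF _ _ _ U(1) brJ U(2,3) le] by blast
    qed
    ultimately show "bracketing_le ?J U" by (simp add: bracketing_le_def)
  qed
qed

text \<open>The right side depends on \<open>B\<close> only in appearance: it keeps exactly the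
  trivial brackets, which lie in every bracketing and are ordered alike in all of them.\<close>

lemma support_bottom: "\<bottom>\<^bsub>cat_assoc T\<^esub> = support_bracketing T B (\<lambda>A. 0)"
proof (rule bottom_cat_assoc_eqI)
  let ?J = "support_bracketing T B (\<lambda>A. 0)"
  show brJ: "bracketing T ?J" by (rule bracketing_support[OF lengths_on_zero])
  fix U assume U: "bracketing T U"
  interpret J: plane_bracketing T ?J using brJ by unfold_locales
  interpret U: plane_bracketing T U using U by unfold_locales
  have triv: "\<not> nontrivial_bracket T A" if "A \<in> all_brs ?J" for A using that by (simp add: all_brs_support)
  have "brs ?J k \<subseteq> brs U k" for k
    using J.brs_all_brs U.brs_all_brs U.trivial_brs triv by blast
  moreover have "prec ?J = prec U \<inter> (all_brs ?J \<times> all_brs ?J)"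
  proof (intro equalityI subrelI)
    fix A1 A2 assume A: "(A1, A2) \<in> prec ?J"
    then have "A1 \<in> all_brs ?J" "A2 \<in> all_brs ?J" using J.prec_all_brs by auto
    with prec_trivial[OF brJ U triv triv A]
    show "(A1, A2) \<in> prec U \<inter> (all_brs ?J \<times> all_brs ?J)" by blast
  next
    fix A1 A2 assume "(A1, A2) \<in> prec U \<inter> (all_brs ?J \<times> all_brs ?J)"
    then show "(A1, A2) \<in> prec ?J" using prec_trivial[OF U brJ triv triv] by blast
  qed
  ultimately show "bracketing_le ?J U" by (simp add: bracketing_le_def)
qed

lemma metric_of_add:
  "\<lbrakk>l1 \<in> lengths_on T B; l2 \<in> lengths_on T B\<rbrakk> \<Longrightarrow>
    metric_of l1 \<oplus>\<^bsub>met_space T\<^esub> metric_of l2 = metric_of (\<lambda>A. l1 A + l2 A)"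
  by (simp add: metric_of_def support_join)

text \<open>A nonzero factor preserves the support. At \<open>t = 0\<close> the support shrinks to
  the trivial brackets, in agreement with the special case in \<open>met_space\<close>.\<close>

lemma metric_of_smult: "t \<odot>\<^bsub>met_space T\<^esub> metric_of l = metric_of (\<lambda>A. t * l A)"
  by (simp add: metric_of_def support_bottom) (simp add: support_bracketing_def)

lemma metric_of_zero: "\<zero>\<^bsub>met_space T\<^esub> = metric_of (\<lambda>A. 0)"
  by (simp add: metric_of_def support_bottom)

lemma tau_met_add:
  "\<lbrakk>x \<in> tau_met T B; y \<in> tau_met T B\<rbrakk> \<Longrightarrow> x \<oplus>\<^bsub>met_space T\<^esub> y \<in> tau_met T B"
  by (auto simp: tau_met_metric_of metric_of_add intro!: imageI lengths_on_add)

lemma tau_met_smult: "\<lbrakk>0 \<le> t; x \<in> tau_met T B\<rbrakk> \<Longrightarrow> t \<odot>\<^bsub>met_space T\<^esub> x \<in> tau_met T B"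
  by (auto simp: tau_met_metric_of metric_of_smult intro!: imageI lengths_on_scale)

lemma tau_met_zero: "\<zero>\<^bsub>met_space T\<^esub> \<in> tau_met T B"
  using lengths_on_zero by (auto simp: tau_met_metric_of metric_of_zero simp del: met_space_simps)

lemma tau_met_add_le:
  assumes "x \<in> tau_met T B" "y \<in> tau_met T B"
  shows "bracketing_le (fst x) (fst (x \<oplus>\<^bsub>met_space T\<^esub> y))"
    and "bracketing_le (fst y) (fst (x \<oplus>\<^bsub>met_space T\<^esub> y))"
proof -
  obtain l1 l2 where l: "l1 \<in> lengths_on T B" "l2 \<in> lengths_on T B" "x = metric_of l1" "y = metric_of l2"
    using assms by (auto simp: tau_met_metric_of)
  have "l1 A + l2 A \<noteq> 0 \<longleftrightarrow> l1 A \<noteq> 0 \<or> l2 A \<noteq> 0" if "nontrivial_bracket T A" for A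
    using lengths_onD(3)[OF l(1) that] lengths_onD(3)[OF l(2) that] by linarith
  then show "bracketing_le (fst x) (fst (x \<oplus>\<^bsub>met_space T\<^esub> y))"
    "bracketing_le (fst y) (fst (x \<oplus>\<^bsub>met_space T\<^esub> y))"
    using l by (auto simp: metric_of_add intro!: support_mono)
qed

text \<open>Through \<open>metric_of\<close> every semimodule law becomes the pointwise law for real
  functions, so only closure of \<open>S\<close> is left to check.\<close>

lemma conical_set_subset:
  assumes S: "S \<subseteq> tau_met T B" and zero: "\<zero>\<^bsub>met_space T\<^esub> \<in> S"
    and add: "\<And>x y. \<lbrakk>x \<in> S; y \<in> S\<rbrakk> \<Longrightarrow> x \<oplus>\<^bsub>met_space T\<^esub> y \<in> S"
    and smult: "\<And>t x. \<lbrakk>0 \<le> t; x \<in> S\<rbrakk> \<Longrightarrow> t \<odot>\<^bsub>met_space T\<^esub> x \<in> S"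
  shows "conical_set (met_space T\<lparr>carrier := S\<rparr>)"
proof -
  have ex: "\<exists>l\<in>lengths_on T B. x = metric_of l" if "x \<in> S" for x
    using that S by (auto simp: tau_met_metric_of)
  note [simp del] = met_space_simps and [simp] = metric_of_add metric_of_smult metric_of_zero lengths_on_add lengths_on_scale
  have am: "abelian_monoid (met_space T\<lparr>carrier := S\<rparr>)"
  proof (rule abelian_monoidI)
    fix x y z
    assume "x \<in> carrier (met_space T\<lparr>carrier := S\<rparr>)" "y \<in> carrier (met_space T\<lparr>carrier := S\<rparr>)"
      "z \<in> carrier (met_space T\<lparr>carrier := S\<rparr>)"
    then have "x \<in> S" "y \<in> S" "z \<in> S" by simp_all
    then obtain l1 l2 l3 where "l1 \<in> lengths_on T B" "x = metric_of l1" "l2 \<in> lengths_on T B" "y = metric_of l2"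
      "l3 \<in> lengths_on T B" "z = metric_of l3" using ex by meson
    then show "x \<oplus>\<^bsub>met_space T\<lparr>carrier := S\<rparr>\<^esub> y \<oplus>\<^bsub>met_space T\<lparr>carrier := S\<rparr>\<^esub> z =
        x \<oplus>\<^bsub>met_space T\<lparr>carrier := S\<rparr>\<^esub> (y \<oplus>\<^bsub>met_space T\<lparr>carrier := S\<rparr>\<^esub> z)"
      by (simp add: add.assoc)
  next
    fix x y
    assume "x \<in> carrier (met_space T\<lparr>carrier := S\<rparr>)" "y \<in> carrier (met_space T\<lparr>carrier := S\<rparr>)"
    then have "x \<in> S" "y \<in> S" by simp_all
    then obtain l1 l2 where "l1 \<in> lengths_on T B" "x = metric_of l1" "l2 \<in> lengths_on T B" "y = metric_of l2"
      using ex by meson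
    then show "x \<oplus>\<^bsub>met_space T\<lparr>carrier := S\<rparr>\<^esub> y = y \<oplus>\<^bsub>met_space T\<lparr>carrier := S\<rparr>\<^esub> x"
      by (simp add: add.commute)
  next
    fix x
    assume "x \<in> carrier (met_space T\<lparr>carrier := S\<rparr>)"
    then obtain l where "l \<in> lengths_on T B" "x = metric_of l" using ex by fastforce
    then show "\<zero>\<^bsub>met_space T\<lparr>carrier := S\<rparr>\<^esub> \<oplus>\<^bsub>met_space T\<lparr>carrier := S\<rparr>\<^esub> x = x"
      by (simp add: lengths_on_zero)
  qed (use zero add in simp_all)
  show ?thesis
  proof (rule conical_set.intro[OF am], unfold_locales)
    fix s t :: real and x y
    show "0 \<le> t \<Longrightarrow> x \<in> carrier (met_space T\<lparr>carrier := S\<rparr>) \<Longrightarrow>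
        t \<odot>\<^bsub>met_space T\<lparr>carrier := S\<rparr>\<^esub> x \<in> carrier (met_space T\<lparr>carrier := S\<rparr>)"
      using smult by simp
    show "0 \<le> t \<Longrightarrow> t \<odot>\<^bsub>met_space T\<lparr>carrier := S\<rparr>\<^esub> \<zero>\<^bsub>met_space T\<lparr>carrier := S\<rparr>\<^esub> = \<zero>\<^bsub>met_space T\<lparr>carrier := S\<rparr>\<^esub>"
      by simp
  qed (auto dest!: ex simp: algebra_simps)
qed

text \<open>Membership in the second cone bounds only the bracketing component. Positive scaling
  leaves this component unchanged, and a sum in the first cone lies above both summands.\<close>

lemma is_face_Int:
  assumes "bracketing T B'"
  shows "is_face (met_space T) (tau_met T B \<inter> tau_met T B') (tau_met T B)"
proof -
  interpret B': plane_bracketing T B' using assms by unfold_locales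
  have "conical_set (met_space T\<lparr>carrier := tau_met T B \<inter> tau_met T B'\<rparr>)"
    by (rule conical_set_subset)
      (use tau_met_zero tau_met_add tau_met_smult B'.tau_met_zero B'.tau_met_add B'.tau_met_smult in auto)
  moreover have "x \<in> tau_met T B'"
    if "t > 0" "x \<in> tau_met T B" "t \<odot>\<^bsub>met_space T\<^esub> x \<in> tau_met T B'" for t x
    using that by (cases x) (auto simp: tau_met_def)
  moreover have "x \<in> tau_met T B'" "y \<in> tau_met T B'"
    if "x \<in> tau_met T B" "y \<in> tau_met T B" "x \<oplus>\<^bsub>met_space T\<^esub> y \<in> tau_met T B'" for x y
    using tau_met_add_le[OF that(1,2)] that bracketing_le_trans unfolding tau_met_def by auto
  ultimately show ?thesis unfolding is_face_def by blast
qed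

end

lemma finite_pos_scaling:
  fixes f g :: "'a \<Rightarrow> real"
  assumes "finite N" "\<And>A. A \<in> N \<Longrightarrow> 0 < f A" "\<And>A. A \<in> N \<Longrightarrow> 0 \<le> g A"
  shows "\<exists>e>0. \<forall>A\<in>N. e * g A \<le> f A"
  using assms
proof (induction N rule: finite_induct)
  case empty
  show ?case by (intro exI[of _ 1]) simp
next
  case (insert A N)
  then obtain e where e: "e > 0" "\<forall>A\<in>N. e * g A \<le> f A" by auto
  \<comment> \<open>The summand 1 keeps the denominator positive when
    \<open>g A = 0\<close>.\<close>
  let ?e = "min e (f A / (g A + 1))"
  have fA: "0 < f A" and gA: "0 \<le> g A" using insert.prems by auto
  have "?e * g A \<le> f A / (g A + 1) * g A" using gA by (intro mult_right_mono) auto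
  also have "\<dots> \<le> f A" using fA gA by (simp add: field_simps)
  finally have "?e * g A \<le> f A" .
  moreover have "?e * g A' \<le> f A'" if "A' \<in> N" for A'
  proof -
    have "?e * g A' \<le> e * g A'" using insert.prems(2) that by (intro mult_right_mono) auto
    with e that show ?thesis by fastforce
  qed
  moreover have "?e > 0" using e fA gA by simp
  ultimately show ?case by blast
qed

section \<open>Every face of a cone is the cone of a smaller bracketing\<close>

context plane_bracketing
begin

text \<open>Let \<open>l0\<close> have maximal nontrivial support in \<open>S\<close>. Adding
  \<open>l0\<close> to a member of \<open>S\<close> cannot enlarge this support, so \<open>S\<close>
  lies in the cone of the support of \<open>l0\<close>. Conversely, for \<open>l\<close> in that
  cone, \<open>l0\<close> is the sum of \<open>l0 - e * l\<close> and \<open>e * l\<close> for small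
  \<open>e\<close>, and the face axioms put first \<open>e * l\<close> and then \<open>l\<close>
  into \<open>S\<close>.\<close>

lemma face_is_tau_met:
  assumes face: "is_face (met_space T) S (tau_met T B)"
  shows "\<exists>B'. bracketing T B' \<and> S = tau_met T B'"
proof -
  let ?M = "met_space T"
  interpret S: conical_set "?M\<lparr>carrier := S\<rparr>" using face by (simp add: is_face_def)
  have sub: "S \<subseteq> tau_met T B"
    and smult: "\<And>t x. \<lbrakk>t > 0; x \<in> tau_met T B; t \<odot>\<^bsub>?M\<^esub> x \<in> S\<rbrakk> \<Longrightarrow> x \<in> S"
    and summand: "\<And>x y. \<lbrakk>x \<in> tau_met T B; y \<in> tau_met T B; x \<oplus>\<^bsub>?M\<^esub> y \<in> S\<rbrakk> \<Longrightarrow> y \<in> S"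
    using face unfolding is_face_def by blast+
  define K where "K = {l \<in> lengths_on T B. metric_of l \<in> S}"
  define N where "N = (\<lambda>l :: 'v bracket \<Rightarrow> real. {A \<in> all_brs B. nontrivial_bracket T A \<and> l A \<noteq> 0})"
  have "(\<lambda>A. 0) \<in> K"
    using S.zero_closed lengths_on_zero metric_of_zero by (simp add: K_def del: met_space_simps)
  moreover have "finite (N ` K)"
    by (rule finite_subset[of _ "Pow (all_brs B)"]) (auto simp: N_def finite_all_brs)
  ultimately obtain l0 where l0: "l0 \<in> K" and max: "\<And>l. \<lbrakk>l \<in> K; N l0 \<subseteq> N l\<rbrakk> \<Longrightarrow> N l0 = N l"
    using finite_has_maximal[of "N ` K"] by blast
  have l0B: "l0 \<in> lengths_on T B" using l0 by (simp add: K_def)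
  let ?B' = "support_bracketing T B l0"
  have brB': "bracketing T ?B'" using bracketing_support[OF l0B] .
  interpret B': plane_bracketing T ?B' using brB' by unfold_locales
  have "S \<subseteq> tau_met T ?B'"
  proof
    fix x assume x: "x \<in> S"
    then obtain l where l: "l \<in> lengths_on T B" "x = metric_of l" using sub by (auto simp: tau_met_metric_of)
    let ?l = "\<lambda>A. l0 A + l A"
    have "metric_of l0 \<oplus>\<^bsub>?M\<^esub> x \<in> S" using S.a_closed[of "metric_of l0" x] x l0 by (simp add: K_def)
    then have "?l \<in> K" using l l0B lengths_on_add by (simp add: K_def metric_of_add)
    moreover have N: "N ?l = N l0 \<union> N l"
      using lengths_onD(3)[OF l0B] lengths_onD(3)[OF l(1)] by (fastforce simp: N_def add_nonneg_eq_0_iff)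
    ultimately have "N l \<subseteq> N l0" using max by blast
    then have "bracketing_le (support_bracketing T B l) ?B'" by (intro support_mono) (auto simp: N_def)
    then show "x \<in> tau_met T ?B'" using metric_support[OF l(1)] l(2) by (simp add: tau_met_def metric_of_def)
  qed
  moreover have "tau_met T ?B' \<subseteq> S"
  proof
    fix x assume x: "x \<in> tau_met T ?B'"
    then obtain l where l: "l \<in> lengths_on T ?B'" "x = B'.metric_of l" by (auto simp: B'.tau_met_metric_of)
    have lB: "l \<in> lengths_on T B" using l(1) lengths_on_mono[OF support_le] by blast
    have "x \<in> tau_met T B" using x support_le bracketing_le_trans by (fastforce simp: tau_met_def)
    \<comment> \<open>\<open>x\<close> lies in both cones and each parametrization has the length as
      second component, so the same \<open>l\<close> describes \<open>x\<close> in either.\<close>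
    then have xl: "x = metric_of l" using l(2) by (auto simp: tau_met_metric_of metric_of_def B'.metric_of_def)
    have "finite (N l0)" by (simp add: N_def finite_all_brs)
    moreover have "0 < l0 A" if "A \<in> N l0" for A using that lengths_onD(3)[OF l0B, of A] by (auto simp: N_def)
    moreover have "0 \<le> l A" if "A \<in> N l0" for A using that lengths_onD(3)[OF lB, of A] by (simp add: N_def)
    ultimately obtain e where e: "e > 0" "\<forall>A\<in>N l0. e * l A \<le> l0 A" using finite_pos_scaling[of "N l0" l0 l] by blast
    \<comment> \<open>The scale \<open>e\<close> controls only nontrivial brackets of the support.
      On maximum brackets \<open>?d\<close> may be negative, which \<open>lengths_on\<close>
      permits.\<close>
    let ?d = "\<lambda>A. l0 A + (- e) * l A"
    have "0 \<le> ?d A" if A: "nontrivial_bracket T A" for A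
    proof (cases "A \<in> N l0")
      case True
      with e show ?thesis by simp
    next
      case False
      then have "A \<notin> all_brs ?B'" using A by (auto simp: N_def all_brs_support)
      then have "l A = 0" using lengths_onD(1)[OF l(1)] by blast
      then show ?thesis using lengths_onD(3)[OF l0B A] by simp
    qed
    moreover have "balanced T ?d"
      by (rule balanced_add[OF lengths_onD(4)[OF l0B] balanced_scale[OF lengths_onD(4)[OF lB]]])
    ultimately have dB: "?d \<in> lengths_on T B"
      using lengths_onD(1,2)[OF l0B] lengths_onD(1,2)[OF lB] by (simp add: lengths_on_def)
    have elB: "(\<lambda>A. e * l A) \<in> lengths_on T B" using lengths_on_scale[OF _ lB] e by simp
    have "metric_of ?d \<oplus>\<^bsub>?M\<^esub> metric_of (\<lambda>A. e * l A) = metric_of l0"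
      using metric_of_add[OF dB elB] by simp
    then have "metric_of (\<lambda>A. e * l A) \<in> S"
      using summand[of "metric_of ?d" "metric_of (\<lambda>A. e * l A)"] dB elB l0 by (simp add: tau_met_metric_of K_def)
    then show "x \<in> S" using smult[OF e(1) \<open>x \<in> tau_met T B\<close>] xl metric_of_smult by simp
  qed
  ultimately show ?thesis using brB' by blast
qed

end

section \<open>Lengths with full support\<close>

text \<open>
  A length is pushed from a bracket to its lifts by halving it along each chain: every lift that
  is not minimal takes half of what the larger ones have left over, a minimal one takes the rest.
\<close>

definition chain_share :: "'v bracketing \<Rightarrow> 'v bracket \<Rightarrow> real" where
  "chain_share B D =
     (let d = card {E \<in> lifts B (butlast D). last D \<subset> last E} in
      if \<exists>E\<in>lifts B (butlast D). last E \<subset> last D then (1 / 2) ^ Suc d else (1 / 2) ^ d)"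

text \<open>Over a singleton base no equation restricts a nonsingleton lift, so any positive
  starting value would do; 1 is chosen. Elsewhere the shares distribute the length of the
  base.\<close>

function halving_length :: "'v plane_tree \<Rightarrow> 'v bracketing \<Rightarrow> 'v bracket \<Rightarrow> real" where
  "halving_length T B A =
     (if A = [] \<or> is_singleton_bracket T A then 0
      else if is_singleton_bracket T (butlast A) then 1
      else chain_share B A * halving_length T B (butlast A))"
  by pat_completeness auto
termination
  by (relation "measure (\<lambda>(T, B, A). length A)") auto

declare halving_length.simps [simp del]

lemma sum_halves: "(\<Sum>i<n. (1 / 2 :: real) ^ Suc i) + (1 / 2) ^ n = 1"
  by (induction n) auto

context plane_bracketing
begin

lemma chain_share_pos: "0 < chain_share B D"
  by (simp add: chain_share_def Let_def)

text \<open>The lifts through \<open>v\<close> form a chain with least element \<open>m\<close>. The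
  \<open>n\<close> lifts above \<open>m\<close> have the distinct depths 0, ...,
  \<open>n - 1\<close> and take 1/2, 1/4, and so on; \<open>m\<close> has depth \<open>n\<close> and
  takes the remainder.\<close>

lemma sum_chain_share:
  assumes C: "C \<in> all_brs B" and uv: "u \<in> last C" "v \<in> set (kids T u)"
  shows "(\<Sum>D\<in>{D \<in> lifts B C. v \<in> last D}. chain_share B D) = 1"
proof -
  let ?S = "{D \<in> lifts B C. v \<in> last D}"
  define d where "d D = card {E \<in> lifts B C. last D \<subset> last E}" for D
  have C0: "C \<noteq> []" using C by (rule all_brsE) auto
  have fin: "finite ?S" using finite_lifts by simp
  obtain D0 where D0: "D0 \<in> lifts B C" "v \<in> last D0" using lifts_cover[OF C uv] .
  obtain m where m: "m \<in> lifts B C" "v \<in> last m" "\<forall>F\<in>lifts B C. \<not> last F \<subset> last m"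
    using minimal_lift[OF D0 C0] by metis
  have chain: "last D \<subset> last E \<or> last E \<subset> last D" if "D \<in> ?S" "E \<in> ?S" "D \<noteq> E" for D E
  proof -
    have "last D \<noteq> last E" using that lifts_eq_iff[of D C E] by simp
    moreover have "last D \<subseteq> last E \<or> last E \<subseteq> last D" using that lifts_laminar[of D C E v] by simp
    ultimately show ?thesis by auto
  qed
  \<comment> \<open>The depth of \<open>D\<close> is defined without \<open>v\<close>, so its share
    is the same for all its vertices; it still counts positions in the chain through
    \<open>v\<close>, since every lift containing \<open>D\<close> contains
    \<open>v\<close>.\<close>
  have sub: "{E \<in> lifts B C. last D \<subset> last E} \<subseteq> ?S" if "D \<in> ?S" for D using that by blast
  have d_mono: "d E < d D" if "D \<in> ?S" "E \<in> ?S" "last D \<subset> last E" for D E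
    unfolding d_def using that finite_lifts by (intro psubset_card_mono) auto
  have inj: "inj_on d ?S"
  proof (rule inj_onI, rule ccontr)
    fix D E assume "D \<in> ?S" "E \<in> ?S" "d D = d E" "D \<noteq> E"
    then show False using chain[of D E] d_mono[of D E] d_mono[of E D] by auto
  qed
  define n where "n = card (?S - {m})"
  have mS: "m \<in> ?S" using m by simp
  have above_m: "last m \<subset> last D" if D: "D \<in> ?S - {m}" for D
  proof -
    have "\<not> last D \<subset> last m" "m \<noteq> D" using D m(3) by auto
    then show ?thesis using chain[OF mS, of D] D by simp
  qed
  then have "{E \<in> lifts B C. last m \<subset> last E} = ?S - {m}" using sub[OF mS] by blast
  then have dm: "d m = n" by (simp add: d_def n_def)
  have "d ` (?S - {m}) \<subseteq> {..<n}" using d_mono[OF mS] above_m dm by blast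
  moreover have "card (d ` (?S - {m})) = n"
    unfolding n_def by (rule card_image) (rule inj_on_subset[OF inj], blast)
  ultimately have img: "d ` (?S - {m}) = {..<n}" by (intro card_subset_eq) auto
  have share: "chain_share B D = (1 / 2) ^ Suc (d D)" if D: "D \<in> ?S - {m}" for D
  proof -
    have "butlast D = C" using D liftsD(2) by blast
    moreover have "\<exists>E\<in>lifts B C. last E \<subset> last D" using above_m[OF D] m(1) by blast
    ultimately show ?thesis by (simp add: chain_share_def d_def Let_def)
  qed
  have "butlast m = C" using m(1) liftsD(2) by blast
  then have "chain_share B m = (1 / 2) ^ n" using m(3) dm by (simp add: chain_share_def d_def Let_def)
  moreover have "(\<Sum>D\<in>?S - {m}. chain_share B D) = (\<Sum>i<n. (1 / 2) ^ Suc i)"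
  proof -
    have "(\<Sum>D\<in>?S - {m}. chain_share B D) = (\<Sum>D\<in>?S - {m}. (1 / 2) ^ Suc (d D))"
      using share by (rule sum.cong[OF refl])
    also have "\<dots> = (\<Sum>i\<in>d ` (?S - {m}). (1 / 2) ^ Suc i)"
      using inj_on_subset[OF inj] by (subst sum.reindex) (auto simp: o_def)
    finally show ?thesis unfolding img .
  qed
  ultimately show ?thesis
    using sum.remove[OF fin mS, of "chain_share B"] sum_halves[of n] by simp
qed

lemma halving_length_pos:
  assumes "A \<in> all_brs B" "\<not> is_singleton_bracket T A"
  shows "0 < halving_length T B A"
  using assms
proof (induction "length A" arbitrary: A)
  case 0
  then show ?case using bracketsD(2) by (auto elim!: all_brsE)
next
  case (Suc n)
  obtain k where k: "A \<in> brs B k" "A \<in> brackets T k" "length A = Suc k" using Suc.prems(1) by (rule all_brsE)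
  then have "k \<noteq> 0" using singleton_root Suc.prems(2) by metis
  then obtain j where j: "k = Suc j" by (cases k) auto
  have "butlast A \<in> all_brs B" using butlast_brs k(1) j unfolding all_brs_def by blast
  moreover have "n = length (butlast A)" using Suc.hyps(2) by simp
  ultimately have "\<not> is_singleton_bracket T (butlast A) \<Longrightarrow> 0 < halving_length T B (butlast A)"
    using Suc.hyps(1) by blast
  then show ?case
    using Suc.prems(2) bracketsD(2)[OF k(2)] chain_share_pos[of A]
    by (subst halving_length.simps) auto
qed

lemma full_length_exists:
  "\<exists>l\<in>lengths_on T B. \<forall>A\<in>all_brs B. nontrivial_bracket T A \<longrightarrow> 0 < l A"
proof -
  let ?l = "\<lambda>A. if A \<in> all_brs B then halving_length T B A else 0"
  have off: "?l A = 0" if "A \<notin> all_brs B" for A using that by simp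
  have pos: "0 < ?l A" if "A \<in> all_brs B" "\<not> is_singleton_bracket T A" for A
    using that halving_length_pos by simp
  have "balanced T ?l"
  proof (rule iffD2[OF balanced_iff]; (intro ballI impI)?)
    show "?l A = 0" if "A \<notin> all_brs B" for A using that by simp
  next
    fix C u v assume C: "C \<in> all_brs B" "\<not> is_singleton_bracket T C" and uv: "u \<in> last C" "v \<in> set (kids T u)"
    have C0: "C \<noteq> []" using C(1) by (rule all_brsE) auto
    have "?l D = chain_share B D * ?l C" if D: "D \<in> lifts B C" for D
      using liftsD(1,2,4)[OF D] lifts_nontrivial(1)[OF D C0 C(2)] C
      by (simp add: halving_length.simps[of T B D])
    then have "(\<Sum>D\<in>{D \<in> lifts B C. v \<in> last D}. ?l D) = (\<Sum>D\<in>{D \<in> lifts B C. v \<in> last D}. chain_share B D) * ?l C"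
      unfolding sum_distrib_right by (intro sum.cong refl) blast
    also have "\<dots> = ?l C" using sum_chain_share[OF C(1) uv] by simp
    also have "(\<Sum>D\<in>{D \<in> lifts B C. v \<in> last D}. ?l D) = lift_sum T ?l C v"
      by (rule lift_sum_lifts[symmetric]) simp
    finally show "?l C = lift_sum T ?l C v" by simp
  qed
  moreover have "0 \<le> ?l A" if "nontrivial_bracket T A" for A
    using pos[of A] that by (cases "A \<in> all_brs B") (auto simp: nontrivial_bracket_def less_imp_le)
  moreover have "?l A = 0" if "is_singleton_bracket T A" for A
    using that by (simp add: halving_length.simps)
  ultimately have "?l \<in> lengths_on T B" unfolding lengths_on_def using off by blast
  moreover have "\<forall>A\<in>all_brs B. nontrivial_bracket T A \<longrightarrow> 0 < ?l A"
    using pos by (simp add: nontrivial_bracket_def)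
  ultimately show ?thesis by (intro bexI[of _ ?l])
qed

lemma tau_met_full_exists: "\<exists>l. (B, l) \<in> tau_met T B"
proof -
  obtain l where "l \<in> lengths_on T B" "\<forall>A\<in>all_brs B. nontrivial_bracket T A \<longrightarrow> 0 < l A"
    using full_length_exists by blast
  then have "(B, l) \<in> tau_met T B" by (simp add: tau_met_def metric_bracketing_iff bracketing_le_refl)
  then show ?thesis by blast
qed

end

section \<open>Comparison of cones, finiteness, and the two partial orders\<close>

context rooted_plane_tree
begin

text \<open>An element of full support has \<open>B1\<close> itself as bracketing, so its membership
  in the second cone already is the inequality.\<close>

lemma tau_met_subset_iff:
  assumes "bracketing T B1" "bracketing T B2"
  shows "tau_met T B1 \<subseteq> tau_met T B2 \<longleftrightarrow> bracketing_le B1 B2"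
proof
  interpret B1: plane_bracketing T B1 using assms by unfold_locales
  obtain l where "(B1, l) \<in> tau_met T B1" using B1.tau_met_full_exists by blast
  moreover assume "tau_met T B1 \<subseteq> tau_met T B2"
  ultimately show "bracketing_le B1 B2" by (auto simp: tau_met_def)
next
  assume "bracketing_le B1 B2"
  then show "tau_met T B1 \<subseteq> tau_met T B2" using bracketing_le_trans by (auto simp: tau_met_def)
qed

lemma is_face_tau_met_iff:
  assumes "bracketing T B1" "bracketing T B2"
  shows "is_face (met_space T) (tau_met T B1) (tau_met T B2) \<longleftrightarrow> bracketing_le B1 B2"
proof
  assume "is_face (met_space T) (tau_met T B1) (tau_met T B2)"
  then show "bracketing_le B1 B2" using tau_met_subset_iff[OF assms] by (simp add: is_face_def)
next
  interpret B2: plane_bracketing T B2 using assms by unfold_locales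
  assume "bracketing_le B1 B2"
  then have "tau_met T B2 \<inter> tau_met T B1 = tau_met T B1" using tau_met_subset_iff[OF assms] by blast
  then show "is_face (met_space T) (tau_met T B1) (tau_met T B2)"
    using B2.is_face_Int[OF assms(1)] by simp
qed

text \<open>\<open>brs\<close> is a function on all naturals, but the level of a bracket is visible
  in its length; hence the finite sets \<open>all_brs\<close> and \<open>prec\<close> determine the
  bracketing.\<close>

lemma finite_bracketings: "finite {B. bracketing T B}"
proof -
  let ?X = "\<Union>k. brackets T k"
  have "inj_on (\<lambda>B. (all_brs B, prec B)) {B. bracketing T B}"
  proof (rule inj_onI)
    fix B1 B2 :: "'v bracketing"
    assume br: "B1 \<in> {B. bracketing T B}" "B2 \<in> {B. bracketing T B}"
      and eq: "(all_brs B1, prec B1) = (all_brs B2, prec B2)"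
    interpret B1: plane_bracketing T B1 using br by unfold_locales simp
    interpret B2: plane_bracketing T B2 using br by unfold_locales simp
    have "brs B1 k = brs B2 k" for k using B1.brs_all_brs B2.brs_all_brs eq by blast
    then show "B1 = B2" using eq by (intro bracketing_le_antisym) (use B1.prec_all_brs B2.prec_all_brs in \<open>auto simp: bracketing_le_def\<close>)
  qed
  moreover have "(\<lambda>B. (all_brs B, prec B)) ` {B. bracketing T B} \<subseteq> Pow ?X \<times> Pow (?X \<times> ?X)"
  proof clarify
    fix B :: "'v bracketing" assume "bracketing T B"
    then interpret plane_bracketing T B by unfold_locales
    show "all_brs B \<in> Pow ?X \<and> prec B \<in> Pow (?X \<times> ?X)"
      using all_brs_brackets prec_all_brs by blast
  qed
  ultimately show ?thesis
    using finite_all_brackets by (meson finite_Pow_iff finite_SigmaI finite_imageD finite_subset)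
qed

lemma weak_partial_order_cat_assoc: "weak_partial_order (cat_assoc T)"
proof unfold_locales
  fix B assume "B \<in> carrier (cat_assoc T)"
  then interpret plane_bracketing T B by unfold_locales simp
  show "B \<sqsubseteq>\<^bsub>cat_assoc T\<^esub> B" by (simp add: bracketing_le_refl)
qed (auto simp: cat_assoc_def intro: bracketing_le_antisym bracketing_le_trans)

text \<open>Between members of \<open>K_met T\<close> being a face is the same as inclusion, which
  supplies the order axioms.\<close>

lemma weak_partial_order_face_poset: "weak_partial_order (face_poset (met_space T) (K_met T))"
proof -
  let ?P = "face_poset (met_space T) (K_met T)"
  have le: "is_face (met_space T) (tau_met T B1) (tau_met T B2) \<longleftrightarrow> tau_met T B1 \<subseteq> tau_met T B2"
    if "bracketing T B1" "bracketing T B2" for B1 B2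
    using that is_face_tau_met_iff tau_met_subset_iff by blast
  show ?thesis
    by unfold_locales (auto simp: face_poset_def K_met_def le)
qed

end

section \<open>Polyhedrality\<close>

text \<open>The matrix has one row per functional and one column per element of \<open>X\<close>,
  numbered by \<open>e\<close>. Values of \<open>g\<close> outside \<open>X\<close> affect neither
  the inequalities nor the vector.\<close>

lemma polyhedral_cone_functionals:
  fixes e :: "nat \<Rightarrow> 'a" and \<Phi> :: "('a \<Rightarrow> real) set"
  assumes e: "bij_betw e {0..<N} X" and fin: "finite \<Phi>"
  shows "polyhedral_cone N ((\<lambda>g. vec N (\<lambda>i. g (e i))) ` {g. \<forall>c\<in>\<Phi>. 0 \<le> (\<Sum>x\<in>X. c x * g x)})"
    (is "polyhedral_cone N (?v ` ?G)")
proof -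
  obtain cs where cs: "set cs = \<Phi>" using finite_list[OF fin] by blast
  define Q where "Q = mat (length cs) N (\<lambda>(j, i). (cs ! j) (e i))"
  have Q: "Q \<in> carrier_mat (length cs) N" by (simp add: Q_def)
  have entry: "(Q *\<^sub>v ?v g) $ j = (\<Sum>x\<in>X. (cs ! j) x * g x)" if "j < length cs" for g j
  proof -
    have "(Q *\<^sub>v ?v g) $ j = (\<Sum>i\<in>{0..<N}. (cs ! j) (e i) * g (e i))"
      using that by (simp add: Q_def scalar_prod_def)
    also have "\<dots> = (\<Sum>x\<in>X. (cs ! j) x * g x)"
      by (rule sum.reindex_bij_betw[OF e])
    finally show ?thesis .
  qed
  have nonneg: "0\<^sub>v (length cs) \<le> Q *\<^sub>v ?v g \<longleftrightarrow> g \<in> ?G" for g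
  proof -
    have "0\<^sub>v (length cs) \<le> Q *\<^sub>v ?v g \<longleftrightarrow> (\<forall>j<length cs. 0 \<le> (\<Sum>x\<in>X. (cs ! j) x * g x))"
      using entry Q by (auto simp: less_eq_vec_def)
    also have "\<dots> \<longleftrightarrow> (\<forall>c\<in>set cs. 0 \<le> (\<Sum>x\<in>X. c x * g x))"
      by (simp add: all_set_conv_all_nth)
    finally show ?thesis by (simp add: cs)
  qed
  have "?v ` ?G = {x \<in> carrier_vec N. 0\<^sub>v (length cs) \<le> Q *\<^sub>v x}"
  proof (intro equalityI subsetI)
    fix x assume "x \<in> ?v ` ?G"
    then show "x \<in> {x \<in> carrier_vec N. 0\<^sub>v (length cs) \<le> Q *\<^sub>v x}" using nonneg by auto
  next
    fix x assume x: "x \<in> {x \<in> carrier_vec N. 0\<^sub>v (length cs) \<le> Q *\<^sub>v x}"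
    let ?g = "\<lambda>a. x $ inv_into {0..<N} e a"
    have "?g (e i) = x $ i" if "i < N" for i
      using that bij_betw_inv_into_left[OF e] by simp
    then have "x = ?v ?g" using x by (intro eq_vecI) auto
    then show "x \<in> ?v ` ?G" using x nonneg[of ?g] by auto
  qed
  then show ?thesis unfolding polyhedral_cone_def using Q by blast
qed

context plane_bracketing
begin

lemma lengths_on_functionals:
  "\<exists>\<Phi>. finite \<Phi> \<and> (\<forall>l. (\<forall>A. A \<notin> all_brs B \<longrightarrow> l A = 0) \<longrightarrow>
      (l \<in> lengths_on T B \<longleftrightarrow> (\<forall>c\<in>\<Phi>. 0 \<le> (\<Sum>A\<in>all_brs B. c A * l A))))"
proof -
  let ?X = "all_brs B"
  define \<delta> where "\<delta> C A = (if A = C then 1 else 0 :: real)" for C A :: "'v bracket"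
  \<comment> \<open>\<open>\<beta> (C, v)\<close> is the defect of the length equation at
    \<open>C\<close> and \<open>v\<close>: the length of \<open>C\<close> minus the sum over its
    lifts through \<open>v\<close>.\<close>
  define \<beta> where "\<beta> = (\<lambda>(C, v) A. \<delta> C A - (if A \<in> lifts B C \<and> v \<in> last A then 1 else 0))"
  define P where "P = {(C, v). C \<in> ?X \<and> \<not> is_singleton_bracket T C \<and> (\<exists>u\<in>last C. v \<in> set (kids T u))}"
  define S where "S = {A \<in> ?X. is_singleton_bracket T A}"
  define R where "R = {A \<in> ?X. nontrivial_bracket T A}"
  \<comment> \<open>The equations, indexed by \<open>S\<close> and \<open>P\<close>, enter with both
    signs; the inequalities, indexed by \<open>R\<close>, enter once; maximum brackets outside
    \<open>S\<close> get no sign functional.\<close>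
  define \<Phi> where "\<Phi> = \<delta> ` (S \<union> R) \<union> (\<lambda>C A. - \<delta> C A) ` S \<union> \<beta> ` P \<union> (\<lambda>p A. - \<beta> p A) ` P"
  have P_verts: "P \<subseteq> ?X \<times> verts T"
  proof
    fix p assume "p \<in> P"
    then obtain C v u where p: "p = (C, v)" "C \<in> ?X" "u \<in> last C" "v \<in> set (kids T u)" by (auto simp: P_def)
    obtain k where "C \<in> brackets T k" using p(2) by (rule all_brsE)
    then have "u \<in> verts T" using p(3) bracketsD(3) level_verts by blast
    then have "v \<in> verts T" using child_relI[OF _ p(4)] child_relD(2) by blast
    with p show "p \<in> ?X \<times> verts T" by simp
  qed
  have "finite P" using P_verts finite_all_brs finite_verts by (meson finite_SigmaI finite_subset)
  then have fin: "finite \<Phi>" using finite_all_brs by (simp add: \<Phi>_def S_def R_def)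
  have sum_\<delta>: "(\<Sum>A\<in>?X. \<delta> C A * l A) = l C" if "C \<in> ?X" for C l
    using that finite_all_brs by (simp add: \<delta>_def sum.delta' if_distrib[of "\<lambda>x. x * _"] cong: if_cong)
  have sum_\<beta>: "(\<Sum>A\<in>?X. \<beta> (C, v) A * l A) = l C - (\<Sum>D\<in>{D \<in> lifts B C. v \<in> last D}. l D)" if "C \<in> ?X" for C v l
  proof -
    have "(\<Sum>A\<in>?X. (if A \<in> lifts B C \<and> v \<in> last A then 1 else 0) * l A) =
        (\<Sum>A\<in>?X. if A \<in> {D \<in> lifts B C. v \<in> last D} then l A else 0)"
      by (intro sum.cong) auto
    also have "\<dots> = (\<Sum>D\<in>{D \<in> lifts B C. v \<in> last D}. l D)"
      using finite_all_brs liftsD(1) by (subst sum.inter_restrict[symmetric]) (auto intro!: sum.cong)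
    finally show ?thesis
      using sum_\<delta>[OF that, of l] by (simp add: \<beta>_def left_diff_distrib sum_subtractf)
  qed
  have "l \<in> lengths_on T B \<longleftrightarrow> (\<forall>c\<in>\<Phi>. 0 \<le> (\<Sum>A\<in>?X. c A * l A))"
    if off: "\<And>A. A \<notin> ?X \<Longrightarrow> l A = 0" for l
  proof -
    have "balanced T l \<longleftrightarrow> (\<forall>C\<in>?X. \<not> is_singleton_bracket T C \<longrightarrow>
        (\<forall>u\<in>last C. \<forall>v\<in>set (kids T u). l C = lift_sum T l C v))"
      by (rule balanced_iff) (rule off)
    also have "\<dots> \<longleftrightarrow> (\<forall>(C, v)\<in>P. l C = (\<Sum>D\<in>{D \<in> lifts B C. v \<in> last D}. l D))"
      using lift_sum_lifts[of l, OF off] by (fastforce simp: P_def)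
    also have "\<dots> \<longleftrightarrow> (\<forall>p\<in>P. 0 \<le> (\<Sum>A\<in>?X. \<beta> p A * l A) \<and> 0 \<le> (\<Sum>A\<in>?X. - \<beta> p A * l A))"
    proof (rule ball_cong[OF refl])
      fix p assume "p \<in> P"
      then obtain C v where "p = (C, v)" "C \<in> ?X" by (auto simp: P_def)
      then show "(case p of (C, v) \<Rightarrow> l C = (\<Sum>D\<in>{D \<in> lifts B C. v \<in> last D}. l D)) \<longleftrightarrow>
          0 \<le> (\<Sum>A\<in>?X. \<beta> p A * l A) \<and> 0 \<le> (\<Sum>A\<in>?X. - \<beta> p A * l A)"
        using sum_\<beta>[of C v l] by (auto simp: sum_negf)
    qed
    finally have bal: "balanced T l \<longleftrightarrow> \<dots>" .
    have sing: "(\<forall>A. is_singleton_bracket T A \<longrightarrow> l A = 0) \<longleftrightarrow>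
        (\<forall>C\<in>S. 0 \<le> (\<Sum>A\<in>?X. \<delta> C A * l A) \<and> 0 \<le> (\<Sum>A\<in>?X. - \<delta> C A * l A))"
      using sum_\<delta>[of _ l] off by (fastforce simp: S_def sum_negf)
    have nontriv: "(\<forall>A. nontrivial_bracket T A \<longrightarrow> 0 \<le> l A) \<longleftrightarrow> (\<forall>C\<in>R. 0 \<le> (\<Sum>A\<in>?X. \<delta> C A * l A))"
      using sum_\<delta>[of _ l] off by (fastforce simp: R_def)
    have "l \<in> lengths_on T B \<longleftrightarrow> (\<forall>A. is_singleton_bracket T A \<longrightarrow> l A = 0) \<and>
        (\<forall>A. nontrivial_bracket T A \<longrightarrow> 0 \<le> l A) \<and> balanced T l"
      using off by (simp add: lengths_on_def)
    also have "\<dots> \<longleftrightarrow> (\<forall>c\<in>\<Phi>. 0 \<le> (\<Sum>A\<in>?X. c A * l A))"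
      unfolding bal sing nontriv \<Phi>_def by (simp add: ball_Un ball_conj_distrib) blast
    finally show ?thesis .
  qed
  with fin show ?thesis by blast
qed

lemma abstract_cone_tau_met: "abstract_cone (met_space T\<lparr>carrier := tau_met T B\<rparr>)"
proof -
  note [simp del] = met_space_simps
  let ?X = "all_brs B"
  obtain e where e: "bij_betw e {0..<card ?X} ?X" using ex_bij_betw_nat_finite[OF finite_all_brs] by blast
  obtain \<Phi> :: "('v bracket \<Rightarrow> real) set" where fin: "finite \<Phi>"
    and \<Phi>: "\<And>l. \<forall>A. A \<notin> ?X \<longrightarrow> l A = 0 \<Longrightarrow>
      l \<in> lengths_on T B \<longleftrightarrow> (\<forall>c\<in>\<Phi>. 0 \<le> (\<Sum>A\<in>?X. c A * l A))"
    using lengths_on_functionals by auto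
  let ?v = "\<lambda>g. vec (card ?X) (\<lambda>i. g (e i) :: real)"
  let ?G = "{g. \<forall>c\<in>\<Phi>. 0 \<le> (\<Sum>A\<in>?X. c A * g A)}"
  have "?v ` lengths_on T B = ?v ` ?G"
  proof (intro equalityI subsetI)
    fix x assume "x \<in> ?v ` lengths_on T B"
    then obtain l where l: "l \<in> lengths_on T B" "x = ?v l" by blast
    have "l \<in> ?G" using \<Phi>[of l] lengths_onD(1)[OF l(1)] l(1) by blast
    with l(2) show "x \<in> ?v ` ?G" by blast
  next
    fix x assume "x \<in> ?v ` ?G"
    then obtain g where g: "g \<in> ?G" "x = ?v g" by blast
    \<comment> \<open>A solution \<open>g\<close> of the inequalities is arbitrary outside
      \<open>B\<close>. Cutting it off there gives a genuine length with the same coordinate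
      vector.\<close>
    let ?l = "\<lambda>A. if A \<in> ?X then g A else 0"
    have "(\<Sum>A\<in>?X. c A * ?l A) = (\<Sum>A\<in>?X. c A * g A)" for c by (intro sum.cong) auto
    then have "?l \<in> lengths_on T B" using \<Phi>[of ?l] g(1) by simp
    moreover have "x = ?v ?l" using g(2) bij_betwE[OF e] by (intro eq_vecI) auto
    ultimately show "x \<in> ?v ` lengths_on T B" by (intro image_eqI[of _ _ ?l])
  qed
  moreover have "inj_on ?v (lengths_on T B)"
  proof (rule inj_onI, rule ext)
    fix l1 l2 A assume l: "l1 \<in> lengths_on T B" "l2 \<in> lengths_on T B" and eq: "?v l1 = ?v l2"
    show "l1 A = l2 A"
    proof (cases "A \<in> ?X")
      case True
      then obtain i where "i < card ?X" "A = e i" using e by (force simp: bij_betw_def)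
      with arg_cong[OF eq, of "\<lambda>x. x $ i"] show ?thesis by simp
    next
      case False
      then show ?thesis using l lengths_onD(1) by metis
    qed
  qed
  ultimately have bij_v: "bij_betw ?v (lengths_on T B) (?v ` ?G)" by (simp add: bij_betw_def)
  have inj_m: "inj_on snd (tau_met T B)" and img_m: "snd ` tau_met T B = lengths_on T B"
    by (auto simp: tau_met_metric_of inj_on_def image_image)
  have bij: "bij_betw (?v \<circ> snd) (tau_met T B) (?v ` ?G)"
    by (rule bij_betw_trans[OF _ bij_v]) (simp add: bij_betw_def inj_m img_m)
  have "(?v \<circ> snd) (x \<oplus>\<^bsub>met_space T\<^esub> y) = (?v \<circ> snd) x + (?v \<circ> snd) y"
    if "x \<in> tau_met T B" "y \<in> tau_met T B" for x y
    using that by (auto simp: tau_met_metric_of metric_of_add intro!: eq_vecI)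
  moreover have "(?v \<circ> snd) (t \<odot>\<^bsub>met_space T\<^esub> x) = t \<cdot>\<^sub>v (?v \<circ> snd) x"
    if "x \<in> tau_met T B" for t x
    using that by (auto simp: tau_met_metric_of metric_of_smult intro!: eq_vecI)
  moreover have "conical_set (met_space T\<lparr>carrier := tau_met T B\<rparr>)"
    by (rule conical_set_subset) (use tau_met_zero tau_met_add tau_met_smult in auto)
  ultimately show ?thesis
    unfolding abstract_cone_def
    using polyhedral_cone_functionals[OF e fin] bij
    by (intro conjI exI[of _ "card ?X"] exI[of _ "?v ` ?G"] exI[of _ "?v \<circ> snd"]) auto
qed

end

theorem proposition3p54:
  fixes T :: "'v plane_tree"
  assumes "plane_tree T"
    and "1 \<le> depth T"
    and "\<not> is_path T"
  shows "abstract_fan (met_space T) (K_met T) \<and>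
    bij_betw (tau_met T) (carrier (cat_assoc T)) (carrier (face_poset (met_space T) (K_met T))) \<and>
    order_emb (cat_assoc T) (face_poset (met_space T) (K_met T)) (tau_met T)"
proof (intro conjI)
  interpret rooted_plane_tree T using assms(1) by unfold_locales
  have K: "K_met T = tau_met T ` {B. bracketing T B}" by (simp add: K_met_def)
  have loc: "plane_bracketing T B" if "bracketing T B" for B using that by unfold_locales
  show "abstract_fan (met_space T) (K_met T)"
    unfolding abstract_fan_def
  proof (intro conjI ballI allI impI)
    show "finite (K_met T)" using finite_bracketings by (simp add: K)
    show "S \<subseteq> carrier (met_space T)" if "S \<in> K_met T" for S
      using that by (auto simp: K tau_met_def)
    show "abstract_cone (met_space T\<lparr>carrier := S\<rparr>)" if "S \<in> K_met T" for S
      using that plane_bracketing.abstract_cone_tau_met[OF loc] by (auto simp: K)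
    show "S' \<in> K_met T" if "S \<in> K_met T" "is_face (met_space T) S' S" for S S'
      using that plane_bracketing.face_is_tau_met[OF loc] by (fastforce simp: K)
    show "is_face (met_space T) (S1 \<inter> S2) S1" if "S1 \<in> K_met T" "S2 \<in> K_met T" for S1 S2
      using that plane_bracketing.is_face_Int[OF loc] by (auto simp: K)
    then show "is_face (met_space T) (S1 \<inter> S2) S2" if "S1 \<in> K_met T" "S2 \<in> K_met T" for S1 S2
      using that by (metis Int_commute)
  qed
  have "inj_on (tau_met T) {B. bracketing T B}"
  proof (rule inj_onI)
    fix B1 B2 assume "B1 \<in> {B. bracketing T B}" "B2 \<in> {B. bracketing T B}" "tau_met T B1 = tau_met T B2"
    then show "B1 = B2"
      using tau_met_subset_iff[of B1 B2] tau_met_subset_iff[of B2 B1] by (auto intro: bracketing_le_antisym)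
  qed
  then show "bij_betw (tau_met T) (carrier (cat_assoc T)) (carrier (face_poset (met_space T) (K_met T)))"
    by (simp add: bij_betw_def face_poset_def K)
  show "order_emb (cat_assoc T) (face_poset (met_space T) (K_met T)) (tau_met T)"
    unfolding order_emb_def using weak_partial_order_cat_assoc weak_partial_order_face_poset is_face_tau_met_iff
    by (simp add: face_poset_def)
qed

end
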